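(* Let $\alpha\ge0$ be real and $r_\alpha(n)=\sqrt[n]{\overline{p}(n)/n^{\alpha}}$. For every integer $n\ge N_T(\alpha)$, the cubic polynomial $$J(x)=\sum_{j=0}^{3}\binom{3}{j}r_\alpha(n-1+j)x^j$$ has three distinct roots, of which one is real and the other two are non-real complex conjugates.
   Context: $\overline{p}(n)$ is the number of overpartitions of $n$ (partitions of $n$ into non-increasing parts in which the first occurrence of each part size may be overlined). Define $\widetilde N_1(\alpha)=\max\{\lceil\sqrt{2\alpha}\rceil,\lceil\sqrt[3]{3\alpha}\rceil,\lceil\sqrt[4]{11\alpha/3}\rceil,\lceil\sqrt[5]{10\alpha}\rceil\}$, $\widetilde N_2(\alpha)=\max\{2,\lceil\sqrt{2\alpha}\rceil,\lceil\sqrt[3]{3\alpha}\rceil,\lceil\sqrt[4]{11\alpha/3}\rceil,\lceil\sqrt[5]{12\alpha}\rceil\}$, $\widetilde N_3(\alpha)=\max\{5505,\lceil(4\alpha/(\alpha^2+1))^{4/3}\rceil,\lceil(4\alpha)^{4/11}\rceil\}$, $\widetilde N(\alpha)=\max_{1\le i\le3}\widetilde N_i(\alpha)$. $n_u(\alpha)=\max\{\lceil e^{(6\alpha+2^{12}+2^{31+18\alpha})/(2+17\alpha)}\rceil,\lceil(4+34\alpha)^{19}\rceil\}$; $n_l(\alpha)=\max\{\lceil e^{258/(80+2^{16+7\alpha})}\rceil,\lceil(160+2^{17+7\alpha})^{19}\rceil\}$; $n_{u_1}(\alpha)=\max\{\lceil e^{(12+4122\pi^2-12\pi^2\log 8+32\alpha\pi^2+2^{31+18\alpha}\pi^2)/(\pi^2(2+17\alpha))}\rceil,\lceil\pi^{38}(4+34\alpha)^{19}\rceil\}$;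 $n_{l_1}(\alpha)=\max\{\lceil e^{(256+\frac{105(9\pi^2(4+\pi^2)-16)}{128\pi^3})/(8(3\alpha+2^{13+7\alpha}+13))}\rceil,\lceil16^{19}(3\alpha+2^{13+7\alpha}+13)^{19}\rceil\}$; $N_1(\alpha)=\max\{n_u(\alpha),n_l(\alpha),n_{u_1}(\alpha),n_{l_1}(\alpha)\}$. $N_2(\alpha)=\max\{\lceil e^{\frac{3+3\alpha-2\log8}{2+2\alpha}}\rceil,\lceil e^{\frac{2\log8-3-3\alpha}{2+2\alpha}}\rceil,\lceil e^{\frac{3/\pi^2+11(1+\alpha)-6\log8}{6+6\alpha}}\rceil,\lceil e^{\frac{6\log8-11(1+\alpha)-3/\pi^2}{6+6\alpha}}\rceil,\lceil(4+4\alpha)^{227}\rceil,\lceil(12+12\alpha)^{227}\rceil\}$. $N_T(\alpha)=\max\{\widetilde N(\alpha),N_1(\alpha),N_2(\alpha),343361460986\}$. *)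

theory Defs
  imports Complex_Main "HOL-Computational_Algebra.Polynomial"
begin

text \<open>
  An overpartition is encoded as the list of its parts, each paired with a flag telling whether
  that part is overlined. Only the first occurrence of a part size may carry the flag.
\<close>

definition is_overpartition :: "(nat \<times> bool) list \<Rightarrow> nat \<Rightarrow> bool" where
  "is_overpartition xs n \<longleftrightarrow>
     sorted_wrt (\<ge>) (map fst xs) \<and>
     (\<forall>p \<in> set xs. fst p > 0) \<and>
     sum_list (map fst xs) = n \<and>
     (\<forall>i < length xs. snd (xs ! i) \<longrightarrow> (\<forall>j < i. fst (xs ! j) \<noteq> fst (xs ! i)))"

definition overpartitions :: "nat \<Rightarrow> nat" where
  "overpartitions n = card {xs. is_overpartition xs n}"

text \<open>The set counted here is finite, so its cardinality is not the junk value \<open>0\<close>.\<close>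

lemma finite_is_overpartition: "finite {xs. is_overpartition xs n}"
proof -
  have len: "length ys \<le> sum_list ys" if "\<forall>y \<in> set ys. y > 0" for ys :: "nat list"
    using that by (induction ys) auto
  have "{xs. is_overpartition xs n} \<subseteq> {xs. set xs \<subseteq> {..n} \<times> UNIV \<and> length xs \<le> n}"
  proof safe
    fix xs assume xs: "is_overpartition xs n"
    { fix a b assume "(a, b) \<in> set xs"
      hence "a \<in> set (map fst xs)" by force
      hence "a \<le> sum_list (map fst xs)" by (intro member_le_sum_list) auto
      thus "a \<le> n" using xs by (simp add: is_overpartition_def) }
    have "length (map fst xs) \<le> sum_list (map fst xs)"
      using xs by (intro len) (auto simp: is_overpartition_def)
    thus "length xs \<le> n" using xs by (simp add: is_overpartition_def)
  qed simp
  moreover have "finite {xs. set xs \<subseteq> {..n} \<times> (UNIV :: bool set) \<and> length xs \<le> n}"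
    by (rule finite_lists_length_le) simp
  ultimately show ?thesis by (rule finite_subset)
qed

definition r :: "real \<Rightarrow> nat \<Rightarrow> real" where
  "r \<alpha> n = root n (real (overpartitions n) / real n powr \<alpha>)"

text \<open>
  The subtraction \<open>n - 1\<close> is on naturals, hence meant for \<open>n \<ge> 1\<close>.
  The coefficients are real; the polynomial is taken over the complex numbers to speak of all
  its roots.
\<close>

definition J :: "real \<Rightarrow> nat \<Rightarrow> complex poly" where
  "J \<alpha> n = (\<Sum>j = 0..3. monom (complex_of_real (real (3 choose j) * r \<alpha> (n - 1 + j))) j)"

text \<open>At \<open>\<alpha> = 0\<close> the two bases in \<open>Nt3\<close> vanish, and \<open>0 powr x = 0\<close> is the intended value.\<close>

definition Nt1 :: "real \<Rightarrow> int" where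
  "Nt1 \<alpha> = Max {\<lceil>sqrt (2 * \<alpha>)\<rceil>, \<lceil>root 3 (3 * \<alpha>)\<rceil>, \<lceil>root 4 (11 * \<alpha> / 3)\<rceil>, \<lceil>root 5 (10 * \<alpha>)\<rceil>}"

definition Nt2 :: "real \<Rightarrow> int" where
  "Nt2 \<alpha> = Max {2, \<lceil>sqrt (2 * \<alpha>)\<rceil>, \<lceil>root 3 (3 * \<alpha>)\<rceil>, \<lceil>root 4 (11 * \<alpha> / 3)\<rceil>, \<lceil>root 5 (12 * \<alpha>)\<rceil>}"

definition Nt3 :: "real \<Rightarrow> int" where
  "Nt3 \<alpha> = Max {5505, \<lceil>(4 * \<alpha> / (\<alpha>\<^sup>2 + 1)) powr (4 / 3)\<rceil>, \<lceil>(4 * \<alpha>) powr (4 / 11)\<rceil>}"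

definition Nt :: "real \<Rightarrow> int" where
  "Nt \<alpha> = Max {Nt1 \<alpha>, Nt2 \<alpha>, Nt3 \<alpha>}"

definition n_u :: "real \<Rightarrow> int" where
  "n_u \<alpha> = Max {\<lceil>exp ((6 * \<alpha> + 2 ^ 12 + 2 powr (31 + 18 * \<alpha>)) / (2 + 17 * \<alpha>))\<rceil>,
                \<lceil>(4 + 34 * \<alpha>) ^ 19\<rceil>}"

definition n_l :: "real \<Rightarrow> int" where
  "n_l \<alpha> = Max {\<lceil>exp (258 / (80 + 2 powr (16 + 7 * \<alpha>)))\<rceil>,
                \<lceil>(160 + 2 powr (17 + 7 * \<alpha>)) ^ 19\<rceil>}"

definition n_u1 :: "real \<Rightarrow> int" where
  "n_u1 \<alpha> = Max {\<lceil>exp ((12 + 4122 * pi\<^sup>2 - 12 * pi\<^sup>2 * ln 8 + 32 * \<alpha> * pi\<^sup>2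
                          + 2 powr (31 + 18 * \<alpha>) * pi\<^sup>2) / (pi\<^sup>2 * (2 + 17 * \<alpha>)))\<rceil>,
                 \<lceil>pi ^ 38 * (4 + 34 * \<alpha>) ^ 19\<rceil>}"

definition n_l1 :: "real \<Rightarrow> int" where
  "n_l1 \<alpha> = Max {\<lceil>exp ((256 + 105 * (9 * pi\<^sup>2 * (4 + pi\<^sup>2) - 16) / (128 * pi ^ 3))
                          / (8 * (3 * \<alpha> + 2 powr (13 + 7 * \<alpha>) + 13)))\<rceil>,
                 \<lceil>16 ^ 19 * (3 * \<alpha> + 2 powr (13 + 7 * \<alpha>) + 13) ^ 19\<rceil>}"

definition N1 :: "real \<Rightarrow> int" where
  "N1 \<alpha> = Max {n_u \<alpha>, n_l \<alpha>, n_u1 \<alpha>, n_l1 \<alpha>}"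

definition N2 :: "real \<Rightarrow> int" where
  "N2 \<alpha> = Max {\<lceil>exp ((3 + 3 * \<alpha> - 2 * ln 8) / (2 + 2 * \<alpha>))\<rceil>,
               \<lceil>exp ((2 * ln 8 - 3 - 3 * \<alpha>) / (2 + 2 * \<alpha>))\<rceil>,
               \<lceil>exp ((3 / pi\<^sup>2 + 11 * (1 + \<alpha>) - 6 * ln 8) / (6 + 6 * \<alpha>))\<rceil>,
               \<lceil>exp ((6 * ln 8 - 11 * (1 + \<alpha>) - 3 / pi\<^sup>2) / (6 + 6 * \<alpha>))\<rceil>,
               \<lceil>(4 + 4 * \<alpha>) ^ 227\<rceil>,
               \<lceil>(12 + 12 * \<alpha>) ^ 227\<rceil>}"

definition N_T :: "real \<Rightarrow> int" where
  "N_T \<alpha> = Max {Nt \<alpha>, N1 \<alpha>, N2 \<alpha>, 343361460986}"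

end

theory Submission
  imports Defs "HOL-Probability.Probability"
begin

text \<open>
  If \<open>r(N - 1) r(N + 1) > r(N)\<^sup>2\<close> with \<open>N = n + 1\<close>, then the quadratic factor that remains after
  removing a real root of the cubic has negative discriminant. With \<open>L = ln pbar\<close>, this log-convexity says
  that \<open>N\<^sup>2 (L (N + 1) + L (N - 1) - 2 L N) - N (L (N + 1) - L (N - 1)) + 2 L N\<close> exceeds \<open>\<alpha>\<close> times
  the same expression for \<open>ln\<close>, which is at most \<open>2 \<alpha> ln N\<close>
  and so is small because \<open>N \<ge> (12 + 12 \<alpha>) ^ 227\<close>.

  The left-hand side is bounded below by \<open>3 / (5 s)\<close>, of order \<open>N\<^sup>1\<^sup>/\<^sup>2\<close>, with the saddle point method.
  The generating function is truncated to parts of size at most \<open>N\<^sup>2\<close>, and \<open>pbar j\<close> is a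
  Fourier coefficient of it on the circle of radius \<open>exp (- s)\<close>, where \<open>s\<close> makes the
  phase stationary for \<open>j = N\<close>. The integrand lies between two Gaussians of variance comparable to
  \<open>s\<^sup>3\<close>, up to a negligible error. Comparing the moments of orders 0, 1 and 2 gives
  \<open>pbar (N + 1) pbar (N - 1) / pbar(N)\<^sup>2 \<ge> 1 - 53/100 s\<^sup>3\<close>, so the second difference costs at most
  \<open>27 / (8 s)\<close>, while \<open>2 L N - N (L (N + 1) - L (N - 1))\<close> is at least \<open>4 / s\<close> up to lower order terms.
\<close>

section \<open>Generating function of overpartitions with bounded parts\<close>

text \<open>The proof is a budget in units of \<open>1 / s\<close>. In
  \<open>2 L N - N (L (N + 1) - L (N - 1))\<close> the terms \<open>2 s N\<close> cancel, leaving
  twice the logarithm of the generating function at radius \<open>exp (- s)\<close>. Asymptotically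
  this is pi^2/2; keeping only the linear term of each logarithm gives 4. The second difference,
  asymptotically -pi^2/8, is allowed to cost 27/8. Most of that loss comes from bounding
  \<open>Im G\<close> by the modulus: its true contribution has smaller order, but seeing this would
  take a finer expansion of the phase. Of the remaining 5/8, a share of 1/40 absorbs all lower order
  terms. The recurring 5/2 is a rational bound for pi^2/4, the sum of 2/m^2 over odd m. Bounding the
  part sizes makes the generating function a finite product, so its logarithm and the moments are
  finite sums over part sizes, free of questions about infinite products. The bound
  \<open>N\<^sup>2\<close> instead of \<open>N\<close> makes the truncation harmless:
  \<open>s N \<ge> 1\<close> forces \<open>exp (- s) ^ (N\<^sup>2) \<le> exp (- N)\<close>.\<close>

definition bounded_overpartitions :: "nat \<Rightarrow> nat \<Rightarrow> (nat \<times> bool) list set" where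
  "bounded_overpartitions K n = {xs. is_overpartition xs n \<and> (\<forall>p\<in>set xs. fst p \<le> K)}"

text \<open>An intermediate class that separates the two factors of
  \<open>(1 + z ^ K) / (1 - z ^ K)\<close>. Passing from parts below \<open>K\<close> to this class
  multiplies the generating function by \<open>1 / (1 - z ^ K)\<close>; allowing one overlined
  \<open>K\<close> then multiplies it by \<open>1 + z ^ K\<close>.\<close>

definition max_plain_overpartitions :: "nat \<Rightarrow> nat \<Rightarrow> (nat \<times> bool) list set" where
  "max_plain_overpartitions K n = {xs \<in> bounded_overpartitions K n. (K, True) \<notin> set xs}"

lemma finite_bounded_overpartitions: "finite (bounded_overpartitions K n)"
  unfolding bounded_overpartitions_def
  by (rule finite_subset[OF _ finite_is_overpartition[of n]]) auto

lemma finite_max_plain_overpartitions: "finite (max_plain_overpartitions K n)"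
  unfolding max_plain_overpartitions_def using finite_bounded_overpartitions by simp

text \<open>The head is always a first occurrence, so its flag \<open>b\<close> is free; a flag on a
  later part of the same size \<open>a\<close> would violate the definition.\<close>

lemma is_overpartition_Cons:
  "is_overpartition ((a, b) # ys) n \<longleftrightarrow>
     0 < a \<and> a \<le> n \<and> (\<forall>p\<in>set ys. fst p \<le> a) \<and> (a, True) \<notin> set ys \<and> is_overpartition ys (n - a)"
proof -
  have first: "(\<forall>i < length ((a, b) # ys). snd (((a, b) # ys) ! i) \<longrightarrow>
          (\<forall>j < i. fst (((a, b) # ys) ! j) \<noteq> fst (((a, b) # ys) ! i)))
     \<longleftrightarrow> (\<forall>i < length ys. snd (ys ! i) \<longrightarrow>
          a \<noteq> fst (ys ! i) \<and> (\<forall>j < i. fst (ys ! j) \<noteq> fst (ys ! i)))" (is "?L \<longleftrightarrow> ?R")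
    by (simp add: All_less_Suc2)
  have in_set: "(a, True) \<notin> set ys \<longleftrightarrow> (\<forall>i < length ys. snd (ys ! i) \<longrightarrow> a \<noteq> fst (ys ! i))"
    unfolding in_set_conv_nth by (metis prod.collapse fst_conv snd_conv)
  have sum: "a + sum_list (map fst ys) = n \<longleftrightarrow> a \<le> n \<and> sum_list (map fst ys) = n - a"
    by auto
  show ?thesis
    unfolding is_overpartition_def first in_set using sum by auto
qed

lemma overpartitions_eq_card_bounded:
  assumes "n \<le> K"
  shows "overpartitions n = card (bounded_overpartitions K n)"
proof -
  have "fst p \<le> K" if "is_overpartition xs n" "p \<in> set xs" for xs p
  proof -
    have "fst p \<le> sum_list (map fst xs)"
      using that by (intro member_le_sum_list) auto
    thus ?thesis using that assms by (simp add: is_overpartition_def)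
  qed
  hence "bounded_overpartitions K n = {xs. is_overpartition xs n}"
    by (auto simp: bounded_overpartitions_def)
  thus ?thesis by (simp add: overpartitions_def)
qed

lemma bounded_overpartitions_0: "bounded_overpartitions 0 n = (if n = 0 then {[]} else {})"
proof -
  have "is_overpartition xs n \<and> (\<forall>p\<in>set xs. fst p \<le> 0) \<longleftrightarrow> xs = [] \<and> n = 0" for xs
    by (cases xs) (auto simp: is_overpartition_def)
  thus ?thesis unfolding bounded_overpartitions_def by auto
qed

lemma bounded_overpartitions_Suc_without:
  "{xs \<in> bounded_overpartitions (Suc K) n. Suc K \<notin> fst ` set xs} = bounded_overpartitions K n"
  by (auto simp: bounded_overpartitions_def image_iff le_Suc_eq) (metis fst_conv)+

lemma max_plain_overpartitions_disjoint:
  "Cons (Suc K, b) ` A \<inter> bounded_overpartitions K n = {}"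
  by (auto simp: bounded_overpartitions_def)

lemma hd_max_part:
  assumes "xs \<in> bounded_overpartitions (Suc K) n" "Suc K \<in> fst ` set xs"
  obtains b ys where "xs = (Suc K, b) # ys"
proof -
  from assms(2) obtain a b ys where xs: "xs = (a, b) # ys"
    by (cases xs) auto
  have "a = Suc K"
  proof -
    have "Suc K \<le> a"
      using assms unfolding xs by (auto simp: bounded_overpartitions_def is_overpartition_Cons)
    thus ?thesis
      using assms unfolding xs by (auto simp: bounded_overpartitions_def)
  qed
  with xs that show thesis by blast
qed

lemma Cons_in_bounded:
  "(Suc K, b) # ys \<in> bounded_overpartitions (Suc K) n \<longleftrightarrow>
     Suc K \<le> n \<and> ys \<in> max_plain_overpartitions (Suc K) (n - Suc K)"
  by (auto simp: bounded_overpartitions_def max_plain_overpartitions_def is_overpartition_Cons)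

text \<open>Parts are non-increasing, so \<open>Suc K\<close>, if it occurs at all, is the head. The
  class reappears on the right because plain copies may be repeated.\<close>

lemma max_plain_overpartitions_rec:
  "max_plain_overpartitions (Suc K) n = bounded_overpartitions K n \<union>
     (if Suc K \<le> n then Cons (Suc K, False) ` max_plain_overpartitions (Suc K) (n - Suc K) else {})"
    (is "?A = ?B \<union> ?C")
proof (intro equalityI subsetI)
  fix xs assume xs: "xs \<in> ?A"
  hence xs': "xs \<in> bounded_overpartitions (Suc K) n" "(Suc K, True) \<notin> set xs"
    by (auto simp: max_plain_overpartitions_def)
  show "xs \<in> ?B \<union> ?C"
  proof (cases "Suc K \<in> fst ` set xs")
    case False
    thus ?thesis using bounded_overpartitions_Suc_without[of K n] xs' by blast
  next
    case True
    from hd_max_part[OF xs'(1) True] obtain b ys where eq: "xs = (Suc K, b) # ys" .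
    have "b = False" using xs' eq by (cases b) auto
    thus ?thesis using xs'(1) unfolding eq Cons_in_bounded by auto
  qed
next
  fix xs assume "xs \<in> ?B \<union> ?C"
  thus "xs \<in> ?A"
  proof
    assume "xs \<in> ?B"
    thus ?thesis
      using bounded_overpartitions_Suc_without[of K n]
      unfolding max_plain_overpartitions_def by force
  next
    assume "xs \<in> ?C"
    then obtain ys where ys: "Suc K \<le> n" "xs = (Suc K, False) # ys"
        "ys \<in> max_plain_overpartitions (Suc K) (n - Suc K)"
      by (auto split: if_splits)
    have "xs \<in> bounded_overpartitions (Suc K) n"
      unfolding ys(2) Cons_in_bounded using ys by blast
    thus ?thesis using ys by (auto simp: max_plain_overpartitions_def)
  qed
qed

text \<open>An overlined \<open>Suc K\<close> can only be the head, and all copies behind it are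
  plain.\<close>

lemma bounded_overpartitions_rec:
  "bounded_overpartitions (Suc K) n = max_plain_overpartitions (Suc K) n \<union>
     (if Suc K \<le> n then Cons (Suc K, True) ` max_plain_overpartitions (Suc K) (n - Suc K) else {})"
    (is "?A = ?B \<union> ?C")
proof (intro equalityI subsetI)
  fix xs assume xs: "xs \<in> ?A"
  show "xs \<in> ?B \<union> ?C"
  proof (cases "(Suc K, True) \<in> set xs")
    case False
    thus ?thesis using xs by (simp add: max_plain_overpartitions_def)
  next
    case True
    hence "Suc K \<in> fst ` set xs" by force
    from hd_max_part[OF xs this] obtain b ys where eq: "xs = (Suc K, b) # ys" .
    have ys: "Suc K \<le> n" "ys \<in> max_plain_overpartitions (Suc K) (n - Suc K)"
      using xs unfolding eq Cons_in_bounded by blast+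
    hence "b" using True unfolding eq by (auto simp: max_plain_overpartitions_def)
    thus ?thesis using ys unfolding eq by auto
  qed
next
  fix xs assume "xs \<in> ?B \<union> ?C"
  thus "xs \<in> ?A"
    by (auto simp: max_plain_overpartitions_def[of _ n] Cons_in_bounded split: if_splits)
qed

lemma card_max_plain_overpartitions_rec:
  "card (max_plain_overpartitions (Suc K) n) = card (bounded_overpartitions K n) +
     (if Suc K \<le> n then card (max_plain_overpartitions (Suc K) (n - Suc K)) else 0)"
proof -
  have "card (max_plain_overpartitions (Suc K) n) = card (bounded_overpartitions K n) +
     card (if Suc K \<le> n then Cons (Suc K, False) ` max_plain_overpartitions (Suc K) (n - Suc K) else {})"
    by (subst max_plain_overpartitions_rec, rule card_Un_disjoint)
       (use finite_bounded_overpartitions finite_max_plain_overpartitions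
          max_plain_overpartitions_disjoint in \<open>simp_all add: Int_commute\<close>)
  thus ?thesis by (simp add: card_image)
qed

lemma card_bounded_overpartitions_rec:
  "card (bounded_overpartitions (Suc K) n) = card (max_plain_overpartitions (Suc K) n) +
     (if Suc K \<le> n then card (max_plain_overpartitions (Suc K) (n - Suc K)) else 0)"
proof -
  have "card (bounded_overpartitions (Suc K) n) = card (max_plain_overpartitions (Suc K) n) +
     card (if Suc K \<le> n then Cons (Suc K, True) ` max_plain_overpartitions (Suc K) (n - Suc K) else {})"
    by (subst bounded_overpartitions_rec, rule card_Un_disjoint)
       (use finite_max_plain_overpartitions in \<open>auto simp: max_plain_overpartitions_def split: if_splits\<close>)
  thus ?thesis by (simp add: card_image)
qed

lemma sums_shift_power:
  fixes z :: "'a :: real_normed_field" and f :: "nat \<Rightarrow> 'a"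
  assumes "(\<lambda>n. f n * z ^ n) sums S"
  shows "(\<lambda>n. (if k \<le> n then f (n - k) else 0) * z ^ n) sums (z ^ k * S)"
proof -
  have "(\<lambda>n. z ^ k * (f n * z ^ n)) sums (z ^ k * S)"
    using assms by (rule sums_mult)
  hence "(\<lambda>n. (if k \<le> n + k then f (n + k - k) else 0) * z ^ (n + k)) sums (z ^ k * S)"
    by (simp add: power_add mult_ac)
  thus ?thesis
    by (subst (asm) sums_iff_shift) simp
qed

text \<open>A partial sum \<open>D\<close> of the new series satisfies
  \<open>D \<le> C + x ^ k * D\<close>, hence \<open>D \<le> C / (1 - x ^ k)\<close>. Convergence
  has to be known before the recursion can be solved for the sum itself.\<close>

lemma summable_geometric_rec:
  fixes c d :: "nat \<Rightarrow> nat" and x :: real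
  assumes x: "0 \<le> x" "x < 1" and k: "0 < k"
    and rec: "\<And>n. d n = c n + (if k \<le> n then d (n - k) else 0)"
    and c: "summable (\<lambda>n. real (c n) * x ^ n)"
  shows "summable (\<lambda>n. real (d n) * x ^ n)"
proof (rule summableI_nonneg_bounded)
  define C where "C = (\<Sum>n. real (c n) * x ^ n)"
  have xk: "x ^ k < 1" using x k by (simp add: power_less_one_iff)
  show "(\<Sum>i<n. real (d i) * x ^ i) \<le> C / (1 - x ^ k)" for n
  proof -
    let ?D = "\<Sum>i<n. real (d i) * x ^ i"
    have "?D = (\<Sum>i<n. real (c i) * x ^ i) + (\<Sum>i<n. (if k \<le> i then real (d (i - k)) else 0) * x ^ i)"
      unfolding sum.distrib[symmetric] by (intro sum.cong refl, subst rec) (auto simp: algebra_simps)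
    also have "(\<Sum>i<n. real (c i) * x ^ i) \<le> C"
      unfolding C_def using x by (intro sum_le_suminf c) auto
    also have "(\<Sum>i<n. (if k \<le> i then real (d (i - k)) else 0) * x ^ i)
        = (\<Sum>i\<in>{k..<n}. real (d (i - k)) * x ^ i)"
      by (intro sum.mono_neutral_cong_right) auto
    also have "\<dots> = (\<Sum>i<n - k. real (d i) * x ^ (i + k))"
      by (rule sum.reindex_bij_witness[of _ "\<lambda>i. i + k" "\<lambda>i. i - k"]) auto
    also have "\<dots> = x ^ k * (\<Sum>i<n - k. real (d i) * x ^ i)"
      by (simp add: power_add sum_distrib_left mult_ac)
    also have "\<dots> \<le> x ^ k * ?D"
      using x by (intro mult_left_mono sum_mono2) auto
    finally have "?D * (1 - x ^ k) \<le> C" by (simp add: algebra_simps)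
    thus ?thesis using xk by (simp add: field_simps)
  qed
qed (use x in auto)

definition overpartition_product :: "nat \<Rightarrow> complex \<Rightarrow> complex" where
  "overpartition_product K z = (\<Prod>k=1..K. (1 + z ^ k) / (1 - z ^ k))"

lemma power_ne_one:
  fixes z :: complex
  assumes "norm z < 1" "0 < k"
  shows "z ^ k \<noteq> 1"
  using assms by (metis norm_one norm_power power_less_one_iff norm_ge_zero less_irrefl)

lemma summable_card_bounded_overpartitions:
  assumes "0 \<le> x" "x < (1 :: real)"
  shows "summable (\<lambda>n. real (card (bounded_overpartitions K n)) * x ^ n)"
proof (induction K)
  case 0
  show ?case
    by (rule summable_finite[of "{0}"]) (auto simp: bounded_overpartitions_0)
next
  case (Suc K)
  have d: "summable (\<lambda>n. real (card (max_plain_overpartitions (Suc K) n)) * x ^ n)"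
    by (rule summable_geometric_rec[OF assms _ card_max_plain_overpartitions_rec Suc.IH]) simp
  from summable_add[OF d sums_summable[OF sums_shift_power[OF summable_sums[OF d]]], of "Suc K"]
  show ?case
    by (rule iffD1[OF summable_cong, rotated])
      (auto simp: card_bounded_overpartitions_rec[of K] algebra_simps)
qed

lemma sums_overpartition_product:
  fixes z :: complex
  assumes z: "norm z < 1"
  shows "(\<lambda>n. of_nat (card (bounded_overpartitions K n)) * z ^ n) sums overpartition_product K z"
proof (induction K)
  case 0
  have "(\<lambda>n. of_nat (card (bounded_overpartitions 0 n)) * z ^ n) = (\<lambda>n. if n = 0 then 1 else 0)"
    by (auto simp: bounded_overpartitions_0)
  thus ?case using sums_single[of 0 "\<lambda>_. 1 :: complex"] by (simp add: overpartition_product_def)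
next
  case (Suc K)
  let ?d = "\<lambda>n. of_nat (card (max_plain_overpartitions (Suc K) n)) :: complex"
  have "summable (\<lambda>n. real (card (max_plain_overpartitions (Suc K) n)) * norm z ^ n)"
    by (rule summable_geometric_rec[OF norm_ge_zero z _ card_max_plain_overpartitions_rec
          summable_card_bounded_overpartitions[OF norm_ge_zero z]]) simp
  hence "summable (\<lambda>n. ?d n * z ^ n)"
    by (intro summable_norm_cancel[where f="\<lambda>n. ?d n * z ^ n"]) (simp add: norm_mult norm_power)
  then obtain D where D: "(\<lambda>n. ?d n * z ^ n) sums D" by (auto simp: summable_def)
  note shift = sums_shift_power[OF D, of "Suc K"]
  have "?d n = of_nat (card (bounded_overpartitions K n)) + (if Suc K \<le> n then ?d (n - Suc K) else 0)" for n
    by (subst card_max_plain_overpartitions_rec) auto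
  hence "(\<lambda>n. ?d n * z ^ n) sums (overpartition_product K z + z ^ Suc K * D)"
    using sums_add[OF Suc.IH shift] by (simp add: distrib_right)
  \<comment> \<open>Uniqueness of the sum turns the recursion into a linear equation for
    \<open>D\<close>, solvable since \<open>z ^ Suc K\<close> is not 1.\<close>
  with D have "D = overpartition_product K z + z ^ Suc K * D" by (rule sums_unique2)
  hence D_eq: "D = overpartition_product K z / (1 - z ^ Suc K)"
    using power_ne_one[OF z, of "Suc K"] by (simp add: field_simps)
  have "of_nat (card (bounded_overpartitions (Suc K) n)) = ?d n + (if Suc K \<le> n then ?d (n - Suc K) else 0)" for n
    by (subst card_bounded_overpartitions_rec) auto
  hence "(\<lambda>n. of_nat (card (bounded_overpartitions (Suc K) n)) * z ^ n) sums (D + z ^ Suc K * D)"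
    using sums_add[OF D shift] by (simp add: distrib_right)
  also have "D + z ^ Suc K * D = overpartition_product (Suc K) z"
    unfolding D_eq overpartition_product_def by (simp add: divide_simps) (simp add: algebra_simps)
  finally show ?case .
qed

section \<open>Fourier coefficients of a power series\<close>

lemma has_integral_cis_int:
  "((\<lambda>y. cis (of_int m * y)) has_integral (if m = 0 then of_real (2 * pi) else 0)) {-pi..pi}"
proof (cases "m = 0")
  case True
  thus ?thesis using has_integral_const_real[of "1 :: complex" "-pi" pi]
    by (simp add: scaleR_conv_of_real)
next
  case False
  have "((\<lambda>y. cis (of_int m * y)) has_integral
      (cis (of_int m * pi) / (\<i> * of_int m) - cis (of_int m * (- pi)) / (\<i> * of_int m))) {-pi..pi}"
  proof (rule fundamental_theorem_of_calculus)
    fix y :: real assume "y \<in> {-pi..pi}"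
    show "((\<lambda>y. cis (of_int m * y) / (\<i> * of_int m)) has_vector_derivative cis (of_int m * y))
        (at y within {-pi..pi})"
      unfolding has_vector_derivative_complex_iff using False
      by (auto intro!: derivative_eq_intros simp: Re_divide Im_divide cis.ctr field_simps power2_eq_square power4_eq_xxxx)
  qed simp
  moreover have "cis (of_int m * (- pi)) = cis (of_int m * pi)"
    using sin_zero_iff_int2[of "of_int m * pi"] by (simp add: complex_eq_iff)
  ultimately show ?thesis using False by simp
qed

text \<open>Uniform convergence on the circle allows termwise integration, and orthogonality of the
  characters leaves the term \<open>i = j\<close>. The circle is run through as
  \<open>cis (- y)\<close>, so extracting the coefficient multiplies by
  \<open>cis (j y)\<close>.\<close>

lemma has_integral_power_series_coeff:
  fixes c :: "nat \<Rightarrow> complex" and F :: "complex \<Rightarrow> complex"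
  assumes q: "0 \<le> q" and summ: "summable (\<lambda>n. norm (c n) * q ^ n)"
    and F: "\<And>z. norm z = q \<Longrightarrow> (\<lambda>n. c n * z ^ n) sums F z"
  shows "((\<lambda>y. F (of_real q * cis (- y)) * cis (of_nat j * y)) has_integral
            of_real (2 * pi * q ^ j) * c j) {-pi..pi}"
proof -
  define f where "f i y = c i * of_real (q ^ i) * cis (of_int (int j - int i) * y)" for i y
  have f_eq: "f i y = c i * (of_real q * cis (- y)) ^ i * cis (of_nat j * y)" for i y
    by (simp add: f_def power_mult_distrib Complex.DeMoivre cis_mult algebra_simps)
  have lim: "uniform_limit {-pi..pi} (\<lambda>n y. \<Sum>i<n. f i y) (\<lambda>y. \<Sum>i. f i y) sequentially"
    using q by (intro Weierstrass_m_test[OF _ summ]) (simp add: f_def norm_mult norm_power)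
  have cont: "continuous_on {-pi..pi} (\<lambda>y. \<Sum>i<n. f i y)" for n
    unfolding f_def by (intro continuous_intros)
  obtain I L where I: "\<And>n. ((\<lambda>y. \<Sum>i<n. f i y) has_integral I n) {-pi..pi}"
    and L: "((\<lambda>y. \<Sum>i. f i y) has_integral L) {-pi..pi}" and "I \<longlonglongrightarrow> L"
    using uniform_limit_integral[OF lim cont sequentially_bot] by metis
  have "I n = of_real (2 * pi * q ^ j) * c j" if "n > j" for n
  proof -
    have "((\<lambda>y. \<Sum>i<n. f i y) has_integral
        (\<Sum>i<n. c i * of_real (q ^ i) * (if int j - int i = 0 then of_real (2 * pi) else 0))) {-pi..pi}"
      unfolding f_def by (intro has_integral_sum has_integral_mult_right has_integral_cis_int) auto
    also have "(\<Sum>i<n. c i * of_real (q ^ i) * (if int j - int i = 0 then of_real (2 * pi) else 0))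
        = (\<Sum>i<n. if i = j then of_real (2 * pi * q ^ j) * c j else 0)"
      by (intro sum.cong) auto
    also have "\<dots> = of_real (2 * pi * q ^ j) * c j"
      using that by simp
    finally show ?thesis using I has_integral_unique by blast
  qed
  hence "I \<longlonglongrightarrow> of_real (2 * pi * q ^ j) * c j"
    by (intro tendsto_eventually eventually_mono[OF eventually_gt_at_top[of j]]) auto
  with \<open>I \<longlonglongrightarrow> L\<close> have "L = of_real (2 * pi * q ^ j) * c j"
    by (rule LIMSEQ_unique)
  moreover have "(\<Sum>i. f i y) = F (of_real q * cis (- y)) * cis (of_nat j * y)" for y
    unfolding f_eq using sums_mult2[OF F[of "of_real q * cis (- y)"]] q
    by (intro sums_unique[symmetric]) (simp add: norm_mult)
  ultimately show ?thesis using L by simp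
qed

section \<open>Gaussian integrals\<close>

lemma integral_even:
  fixes f :: "real \<Rightarrow> real"
  assumes f: "continuous_on {-R..R} f" and even: "\<And>y. f (- y) = f y" and R: "0 \<le> R"
  shows "integral {-R..R} f = 2 * integral {0..R} f"
proof -
  have "integral {-R..0} f + integral {0..R} f = integral {-R..R} f"
    using f R by (intro Henstock_Kurzweil_Integration.integral_combine integrable_continuous_real) auto
  moreover have "integral {-R..0} f = integral {0..R} f"
    using Henstock_Kurzweil_Integration.integral_reflect_real[of R 0 f] even by simp
  ultimately show ?thesis by simp
qed

lemma has_integral_gaussian_half: "((\<lambda>x. exp (- x\<^sup>2)) has_integral (sqrt pi / 2)) {0 :: real..}"
proof -
  have "((\<lambda>x :: real. indicator {0..} x *\<^sub>R exp (- x\<^sup>2)) has_integral (sqrt pi / 2)) UNIV"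
    using gaussian_moment_0 has_integral_integral_lborel
    by (metis (no_types, lifting) has_bochner_integral_iff)
  also have "(\<lambda>x :: real. indicator {0..} x *\<^sub>R exp (- x\<^sup>2)) = (\<lambda>x. if x \<in> {0..} then exp (- x\<^sup>2) else 0)"
    by auto
  finally show ?thesis by (simp only: has_integral_restrict_UNIV)
qed

lemma gaussian_half_upper: "integral {0..T} (\<lambda>x :: real. exp (- x\<^sup>2)) \<le> sqrt pi / 2"
proof -
  have "integral {0..T} (\<lambda>x :: real. exp (- x\<^sup>2)) \<le> integral {0..} (\<lambda>x :: real. exp (- x\<^sup>2))"
    using has_integral_gaussian_half
    by (intro integral_subset_le integrable_continuous_real continuous_intros) (auto simp: integrable_on_def)
  thus ?thesis using has_integral_gaussian_half by (simp add: integral_unique)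
qed

text \<open>Beyond \<open>T\<close> the Gaussian lies below \<open>exp (- T * x)\<close>, whose tail
  integral is \<open>exp (- T\<^sup>2) / T\<close>.\<close>

lemma gaussian_half_lower:
  assumes "0 < T"
  shows "sqrt pi / 2 - exp (- T\<^sup>2) / T \<le> integral {0..T} (\<lambda>x :: real. exp (- x\<^sup>2))"
proof -
  define g where "g x = (if x \<le> T then exp (- x\<^sup>2) else 0) + (if T \<le> x then exp (- T * x) else 0)" for x
  have "((\<lambda>x. if x \<in> {0..T} then exp (- x\<^sup>2) else 0) has_integral
      integral {0..T} (\<lambda>x :: real. exp (- x\<^sup>2))) {0..}"
    by (subst has_integral_restrict)
      (auto intro!: integrable_integral integrable_continuous_real continuous_intros)
  moreover have "((\<lambda>x. if x \<in> {T..} then exp (- T * x) else 0) has_integral (exp (- T * T) / T)) {0..}"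
    using has_integral_exp_minus_to_infinity[OF assms, of T] assms
    by (subst has_integral_restrict) auto
  ultimately have "((\<lambda>x. (if x \<in> {0..T} then exp (- x\<^sup>2) else 0) + (if x \<in> {T..} then exp (- T * x) else 0))
      has_integral (integral {0..T} (\<lambda>x :: real. exp (- x\<^sup>2)) + exp (- T * T) / T)) {0..}"
    by (rule has_integral_add)
  from has_integral_le[OF has_integral_gaussian_half this]
  have "sqrt pi / 2 \<le> integral {0..T} (\<lambda>x :: real. exp (- x\<^sup>2)) + exp (- T * T) / T"
    using assms by (auto simp: power2_eq_square)
  thus ?thesis by (simp add: power2_eq_square)
qed

lemma gaussian_scale:
  assumes "0 < a" "0 \<le> R"
  shows "integral {-R..R} (\<lambda>y :: real. exp (- a * y\<^sup>2)) =
           2 / sqrt a * integral {0..R * sqrt a} (\<lambda>x. exp (- x\<^sup>2))"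
proof -
  have "((\<lambda>x :: real. exp (- (sqrt a * x)\<^sup>2)) has_integral
      (1 / \<bar>sqrt a\<bar>) *\<^sub>R integral {0..R * sqrt a} (\<lambda>x. exp (- x\<^sup>2)))
      ((\<lambda>x. x / sqrt a) ` {0..R * sqrt a})"
    by (intro has_integral_stretch_real integrable_integral integrable_continuous_real continuous_intros)
      (use assms in auto)
  also have "(\<lambda>x. x / sqrt a) ` {0..R * sqrt a} = {0..R}"
    using assms image_mult_atLeastAtMost[of "1 / sqrt a" 0 "R * sqrt a"] by (simp add: field_simps)
  also have "(\<lambda>x :: real. exp (- (sqrt a * x)\<^sup>2)) = (\<lambda>x. exp (- a * x\<^sup>2))"
    using assms by (simp add: power_mult_distrib)
  finally have "integral {0..R} (\<lambda>x. exp (- a * x\<^sup>2)) =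
      1 / sqrt a * integral {0..R * sqrt a} (\<lambda>x. exp (- x\<^sup>2))"
    using assms by (simp add: integral_unique)
  thus ?thesis
    using assms by (subst integral_even) (auto intro!: continuous_intros)
qed

lemma gaussian_integral_upper:
  assumes "0 < a" "0 \<le> R"
  shows "integral {-R..R} (\<lambda>y :: real. exp (- a * y\<^sup>2)) \<le> sqrt (pi / a)"
proof -
  have "2 / sqrt a * integral {0..R * sqrt a} (\<lambda>x. exp (- x\<^sup>2)) \<le> 2 / sqrt a * (sqrt pi / 2)"
    using assms by (intro mult_left_mono gaussian_half_upper) auto
  thus ?thesis unfolding gaussian_scale[OF assms] by (simp add: real_sqrt_divide)
qed

lemma gaussian_integral_lower:
  assumes "0 < a" "0 < R"
  shows "sqrt (pi / a) - 2 * exp (- a * R\<^sup>2) / (a * R) \<le> integral {-R..R} (\<lambda>y :: real. exp (- a * y\<^sup>2))"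
proof -
  have "2 / sqrt a * (sqrt pi / 2 - exp (- (R * sqrt a)\<^sup>2) / (R * sqrt a))
      \<le> 2 / sqrt a * integral {0..R * sqrt a} (\<lambda>x. exp (- x\<^sup>2))"
    using assms by (intro mult_left_mono gaussian_half_lower) auto
  moreover have "2 / sqrt a * (sqrt pi / 2 - exp (- (R * sqrt a)\<^sup>2) / (R * sqrt a)) =
      sqrt (pi / a) - 2 * exp (- a * R\<^sup>2) / (a * R)"
    using assms by (simp add: real_sqrt_divide field_simps power_mult_distrib)
  ultimately show ?thesis unfolding gaussian_scale[OF assms(1) less_imp_le[OF assms(2)]] by (simp only:)
qed

lemma gaussian_first_moment_upper:
  assumes "0 < a" "0 \<le> R"
  shows "integral {-R..R} (\<lambda>y :: real. \<bar>y\<bar> * exp (- a * y\<^sup>2)) \<le> 1 / a"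
proof -
  have "((\<lambda>y. y * exp (- a * y\<^sup>2)) has_integral
      (- exp (- a * R\<^sup>2) / (2 * a) - (- exp (- a * 0\<^sup>2) / (2 * a)))) {0..R}"
    using assms
    by (intro fundamental_theorem_of_calculus)
      (auto intro!: derivative_eq_intros simp flip: has_real_derivative_iff_has_vector_derivative)
  hence "integral {0..R} (\<lambda>y. y * exp (- a * y\<^sup>2)) \<le> 1 / (2 * a)"
    using assms by (simp add: integral_unique field_simps)
  also have "integral {0..R} (\<lambda>y. y * exp (- a * y\<^sup>2)) = integral {0..R} (\<lambda>y. \<bar>y\<bar> * exp (- a * y\<^sup>2))"
    by (intro integral_cong) auto
  finally show ?thesis
    using assms by (subst integral_even) (auto intro!: continuous_intros)
qed

text \<open>Integrating the derivative of \<open>y * exp (- a * y\<^sup>2)\<close> relates this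
  moment to the plain Gaussian integral; the boundary term has the favourable sign and is
  dropped.\<close>

lemma gaussian_second_moment_upper:
  assumes "0 < a" "0 \<le> R"
  shows "integral {-R..R} (\<lambda>y :: real. y\<^sup>2 * exp (- a * y\<^sup>2)) \<le> sqrt (pi / a) / (2 * a)"
proof -
  let ?I0 = "integral {-R..R} (\<lambda>y :: real. exp (- a * y\<^sup>2))"
  let ?I2 = "integral {-R..R} (\<lambda>y :: real. y\<^sup>2 * exp (- a * y\<^sup>2))"
  have "((\<lambda>y. exp (- a * y\<^sup>2) - 2 * a * (y\<^sup>2 * exp (- a * y\<^sup>2))) has_integral
      (R * exp (- a * R\<^sup>2) - (- R) * exp (- a * (- R)\<^sup>2))) {-R..R}"
    using assms
    by (intro fundamental_theorem_of_calculus)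
      (auto intro!: derivative_eq_intros simp: power2_eq_square algebra_simps
         simp flip: has_real_derivative_iff_has_vector_derivative)
  moreover have "((\<lambda>y. exp (- a * y\<^sup>2) - 2 * a * (y\<^sup>2 * exp (- a * y\<^sup>2))) has_integral ?I0 - 2 * a * ?I2) {-R..R}"
    by (intro has_integral_diff has_integral_mult_right integrable_integral
         integrable_continuous_real continuous_intros)
  ultimately have "?I0 - 2 * a * ?I2 = R * exp (- a * R\<^sup>2) - (- R) * exp (- a * (- R)\<^sup>2)"
    by (rule has_integral_unique[THEN sym])
  hence "2 * a * ?I2 = ?I0 - 2 * R * exp (- a * R\<^sup>2)" by simp
  also have "\<dots> \<le> ?I0" using assms by simp
  also have "\<dots> \<le> sqrt (pi / a)" by (rule gaussian_integral_upper[OF assms])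
  finally show ?thesis using assms by (simp add: field_simps)
qed

section \<open>Power series of the inverse hyperbolic tangent\<close>

lemma sinh_ge_self:
  assumes "0 \<le> (u :: real)"
  shows "u \<le> sinh u"
proof -
  have "sinh 0 - 0 \<le> sinh u - u"
  proof (rule DERIV_nonneg_imp_nondecreasing[OF assms])
    fix x :: real
    show "\<exists>y. ((\<lambda>u. sinh u - u) has_real_derivative y) (at x) \<and> 0 \<le> y"
      by (rule exI[of _ "cosh x - 1"]) (auto intro!: derivative_eq_intros simp: cosh_real_ge_1)
  qed
  thus ?thesis by simp
qed

text \<open>The inequality \<open>u\<^sup>3 cosh u \<le> sinh\<^sup>3 u\<close>, written as \<open>u\<^sup>3 \<le> tanh u sinh\<^sup>2 u\<close>,
  follows by integrating three times
  \<open>(1 - t)\<^sup>2 (6 t + 8) \<ge> 0\<close> with \<open>t = 1 - tanh\<^sup>2 u\<close>.\<close>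

lemma cube_times_cosh_le:
  assumes u: "0 \<le> (u :: real)"
  shows "u ^ 3 * cosh u \<le> sinh u ^ 3"
proof -
  define f1 where "f1 u = 2 * tanh u * (1 - (tanh u)\<^sup>2) + 4 * sinh u * cosh u - 6 * u" for u :: real
  define f2 where "f2 u = (tanh u)\<^sup>2 + 2 * (sinh u)\<^sup>2 - 3 * u\<^sup>2" for u :: real
  define f3 where "f3 u = tanh u * (sinh u)\<^sup>2 - u ^ 3" for u :: real
  have cosh2: "(cosh v)\<^sup>2 * (1 - (tanh v)\<^sup>2) = 1" for v :: real
  proof -
    have "cosh v \<noteq> 0" using cosh_real_pos[of v] by simp
    hence "(cosh v)\<^sup>2 * (1 - (tanh v)\<^sup>2) = (cosh v)\<^sup>2 - (sinh v)\<^sup>2"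
      by (simp add: tanh_def field_simps)
    thus ?thesis by (simp add: cosh_square_eq)
  qed
  have f1: "0 \<le> f1 v" if "0 \<le> v" for v
  proof -
    have "f1 0 \<le> f1 v"
    proof (rule DERIV_nonneg_imp_nondecreasing[OF that])
      fix x :: real
      define t where "t = 1 - (tanh x)\<^sup>2"
      have t: "0 < t" using cosh2[of x] cosh_real_pos[of x] unfolding t_def
        by (smt (verit) mult_nonneg_nonpos zero_le_power2)
      have "(cosh x)\<^sup>2 * t = 1" using cosh2 t_def by simp
      hence c: "(cosh x)\<^sup>2 = 1 / t" using t by (simp add: field_simps)
      have "(2 - 6 * (tanh x)\<^sup>2) * (1 - (tanh x)\<^sup>2) + 4 * ((cosh x)\<^sup>2 + (sinh x)\<^sup>2) - 6
          = (6 * t - 4) * t + 4 * (2 / t - 1) - 6"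
        unfolding sinh_square_eq c by (simp add: t_def algebra_simps)
      also have "\<dots> = (1 - t)\<^sup>2 * (6 * t + 8) / t"
        using t by (simp add: field_simps power2_eq_square)
      also have "\<dots> \<ge> 0" using t by simp
      finally show "\<exists>y. (f1 has_real_derivative y) (at x) \<and> 0 \<le> y"
        unfolding f1_def
        by (intro exI conjI, auto intro!: derivative_eq_intros simp: algebra_simps power2_eq_square)
    qed
    thus ?thesis by (simp add: f1_def)
  qed
  have f2: "0 \<le> f2 v" if "0 \<le> v" for v
  proof -
    have "f2 0 \<le> f2 v"
    proof (rule DERIV_nonneg_imp_nondecreasing[OF that])
      fix x :: real assume "0 \<le> x"
      hence "0 \<le> f1 x" by (rule f1)
      thus "\<exists>y. (f2 has_real_derivative y) (at x) \<and> 0 \<le> y"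
        unfolding f2_def f1_def
        by (intro exI conjI, auto intro!: derivative_eq_intros simp: algebra_simps power2_eq_square)
    qed
    thus ?thesis by (simp add: f2_def)
  qed
  have "f3 0 \<le> f3 u"
  proof (rule DERIV_nonneg_imp_nondecreasing[OF u])
    fix x :: real assume "0 \<le> x"
    hence "0 \<le> f2 x" by (rule f2)
    moreover have "(f3 has_real_derivative f2 x) (at x)"
    proof -
      have "(f3 has_real_derivative (1 - (tanh x)\<^sup>2) * (sinh x)\<^sup>2 + tanh x * (2 * sinh x * cosh x) - 3 * x\<^sup>2) (at x)"
        unfolding f3_def by (auto intro!: derivative_eq_intros simp: algebra_simps power2_eq_square)
      moreover have "(1 - (tanh x)\<^sup>2) * (sinh x)\<^sup>2 = (tanh x)\<^sup>2"
      proof -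
        have c: "cosh x \<noteq> 0" using cosh_real_pos[of x] by simp
        have "(cosh x)\<^sup>2 * ((1 - (tanh x)\<^sup>2) * (sinh x)\<^sup>2) = (cosh x)\<^sup>2 * (tanh x)\<^sup>2"
          using cosh2[of x] c unfolding mult.assoc[symmetric]
          by (simp add: tanh_def power_divide)
        thus ?thesis using c by simp
      qed
      moreover have "tanh x * (2 * sinh x * cosh x) = 2 * (sinh x)\<^sup>2"
        by (simp add: tanh_def power2_eq_square)
      ultimately show ?thesis by (simp add: f2_def)
    qed
    ultimately show "\<exists>y. (f3 has_real_derivative y) (at x) \<and> 0 \<le> y" by blast
  qed
  hence "u ^ 3 \<le> tanh u * (sinh u)\<^sup>2" by (simp add: f3_def)
  hence "u ^ 3 * cosh u \<le> tanh u * (sinh u)\<^sup>2 * cosh u"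
    by (rule mult_right_mono) simp
  also have "\<dots> = sinh u ^ 3" by (simp add: tanh_def power2_eq_square power3_eq_cube)
  finally show ?thesis .
qed

section \<open>Finite sums of \<open>k * x ^ k\<close> and \<open>k\<^sup>2 * x ^ k\<close>\<close>

lemma sum_linear_geometric:
  "(1 - x)\<^sup>2 * (\<Sum>k=1..K. real k * x ^ k) = x - (real K + 1) * x ^ (K + 1) + K * x ^ (K + 2)"
  by (induction K) (simp_all add: algebra_simps power2_eq_square)

text \<open>The remainder is expanded in powers of \<open>1 - x\<close> because in this form its
  nonnegativity on the unit interval is easy to see.\<close>

lemma sum_square_geometric:
  "(1 - x) ^ 3 * (\<Sum>k=1..K. (real k)\<^sup>2 * x ^ k) =
     x * (1 + x) - x ^ (K + 1) * (2 + (2 * real K - 1) * (1 - x) + (real K)\<^sup>2 * (1 - x)\<^sup>2)"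
  by (induction K) (simp_all add: algebra_simps power2_eq_square power3_eq_cube)

lemma one_minus_exp_sinh: "1 - exp (- t) = 2 * exp (- t / 2) * sinh (t / 2 :: real)"
  by (simp add: sinh_def algebra_simps flip: exp_add)

text \<open>The full series is \<open>x / (1 - x)\<^sup>2 = 1 / (4 sinh\<^sup>2 (t / 2))\<close>, so
  the bound reduces to \<open>u \<le> sinh u\<close> at \<open>u = t / 2\<close>.\<close>

lemma sum_linear_exp_le:
  assumes t: "0 < t"
  shows "(\<Sum>k=1..K. real k * exp (- t) ^ k) \<le> 1 / t\<^sup>2"
proof -
  define x where "x = exp (- t)"
  have x: "0 < x" "x < 1" using t by (simp_all add: x_def)
  have "K * x ^ (K + 2) \<le> (real K + 1) * x ^ (K + 1)"
    using x by (intro mult_mono power_decreasing) auto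
  hence "(1 - x)\<^sup>2 * (\<Sum>k=1..K. real k * x ^ k) \<le> x"
    unfolding sum_linear_geometric by simp
  hence "t\<^sup>2 * ((1 - x)\<^sup>2 * (\<Sum>k=1..K. real k * x ^ k)) \<le> t\<^sup>2 * x"
    by (rule mult_left_mono) simp
  also have "t\<^sup>2 * x \<le> (1 - x)\<^sup>2"
  proof -
    have "(t / 2)\<^sup>2 \<le> (sinh (t / 2))\<^sup>2"
      using sinh_ge_self[of "t / 2"] t by (intro power_mono) auto
    hence "4 * x * (t / 2)\<^sup>2 \<le> 4 * x * (sinh (t / 2))\<^sup>2"
      using x by (intro mult_left_mono) auto
    also have "\<dots> = (1 - x)\<^sup>2"
      unfolding x_def one_minus_exp_sinh by (simp add: power_mult_distrib flip: exp_double)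
    finally show ?thesis by (simp add: power_divide mult_ac)
  qed
  finally have "(1 - x)\<^sup>2 * (t\<^sup>2 * (\<Sum>k=1..K. real k * x ^ k)) \<le> (1 - x)\<^sup>2 * 1"
    by (simp add: mult_ac)
  hence "t\<^sup>2 * (\<Sum>k=1..K. real k * x ^ k) \<le> 1"
    using x by (subst (asm) mult_le_cancel_left_pos) auto
  thus ?thesis using t by (simp add: x_def field_simps)
qed

text \<open>The full series is \<open>x (1 + x) / (1 - x)^3 = cosh u / (4 sinh^3 u)\<close> at
  \<open>u = t / 2\<close>; the claimed constant 2 is exactly the inequality
  \<open>u^3 cosh u \<le> sinh^3 u\<close>.\<close>

lemma sum_square_exp_le:
  assumes t: "0 < t"
  shows "(\<Sum>k=1..K. (real k)\<^sup>2 * exp (- t) ^ k) \<le> 2 / t ^ 3"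
proof -
  define x where "x = exp (- t)"
  have x: "0 < x" "x < 1" using t by (simp_all add: x_def)
  have "0 \<le> 2 + (2 * real K - 1) * (1 - x) + (real K)\<^sup>2 * (1 - x)\<^sup>2"
  proof -
    have "- 1 * (1 - x) \<le> (2 * real K - 1) * (1 - x)"
      using x by (intro mult_right_mono) auto
    hence "0 \<le> 2 + (2 * real K - 1) * (1 - x)" using x by simp
    thus ?thesis by (rule add_nonneg_nonneg) simp
  qed
  hence "(1 - x) ^ 3 * (\<Sum>k=1..K. (real k)\<^sup>2 * x ^ k) \<le> x * (1 + x)"
    unfolding sum_square_geometric using x by simp
  hence "t ^ 3 * ((1 - x) ^ 3 * (\<Sum>k=1..K. (real k)\<^sup>2 * x ^ k)) \<le> t ^ 3 * (x * (1 + x))"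
    by (rule mult_left_mono) (use t in simp)
  also have "t ^ 3 * (x * (1 + x)) \<le> 2 * (1 - x) ^ 3"
  proof -
    define h where "h = exp (- t / 2)"
    have x_h: "x = h ^ 2" by (simp add: h_def x_def flip: exp_double)
    have h: "0 < h" by (simp add: h_def)
    have c: "1 + x = 2 * h * cosh (t / 2)"
      by (simp add: cosh_def h_def x_def algebra_simps flip: exp_add)
    have s: "1 - x = 2 * h * sinh (t / 2)"
      unfolding x_def h_def by (rule one_minus_exp_sinh)
    have "16 * h ^ 3 * ((t / 2) ^ 3 * cosh (t / 2)) \<le> 16 * h ^ 3 * sinh (t / 2) ^ 3"
      using h t by (intro mult_left_mono cube_times_cosh_le) auto
    moreover have "16 * h ^ 3 * sinh (t / 2) ^ 3 = 2 * (1 - x) ^ 3"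
      unfolding s by (simp add: power_mult_distrib)
    moreover have "16 * h ^ 3 * ((t / 2) ^ 3 * cosh (t / 2)) = t ^ 3 * (x * (1 + x))"
      unfolding c by (simp add: x_h power_divide power2_eq_square power3_eq_cube)
    ultimately show ?thesis by simp
  qed
  finally have "(1 - x) ^ 3 * (t ^ 3 * (\<Sum>k=1..K. (real k)\<^sup>2 * x ^ k)) \<le> (1 - x) ^ 3 * 2"
    by (simp add: mult_ac)
  hence "t ^ 3 * (\<Sum>k=1..K. (real k)\<^sup>2 * x ^ k) \<le> 2"
    using x by (subst (asm) mult_le_cancel_left_pos) auto
  thus ?thesis using t by (simp add: x_def field_simps)
qed

definition artanh_coeff :: "nat \<Rightarrow> real" where
  "artanh_coeff m = (if odd m then 2 / real m else 0)"

lemma artanh_coeff_nonneg [simp]: "0 \<le> artanh_coeff m"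
  by (simp add: artanh_coeff_def)

text \<open>The terms are 2/m^2 for odd m, with total pi^2/4. From
  \<open>(2j + 1)\<^sup>2 \<ge> 4 j (j + 1)\<close> the sum telescopes once the first term 2 is
  split off.\<close>

lemma sum_artanh_coeff_div_le: "(\<Sum>m<n. artanh_coeff m / real m) \<le> 5 / 2"
proof -
  have odd_sum: "(\<Sum>j<Suc n. 2 / (2 * real j + 1)\<^sup>2) \<le> 5 / 2 - 1 / (2 * real (Suc n))" for n
  proof (induction n)
    case (Suc n)
    have "2 / (2 * real (Suc n) + 1)\<^sup>2 \<le> 2 / (4 * real (Suc n) * real (Suc (Suc n)))"
      by (intro divide_left_mono) (auto simp: power2_eq_square algebra_simps intro!: add_pos_nonneg mult_pos_pos)
    also have "\<dots> = 1 / (2 * real (Suc n)) - 1 / (2 * real (Suc (Suc n)))"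
      by (simp add: divide_simps) (simp add: algebra_simps)
    finally show ?case using Suc.IH by simp
  qed simp
  have "(\<Sum>m<n. artanh_coeff m / real m) \<le> (\<Sum>m<2 * Suc n. artanh_coeff m / real m)"
    by (intro sum_mono2) auto
  also have "\<dots> = (\<Sum>j<Suc n. 2 / (2 * real j + 1)\<^sup>2)"
    by (induction n) (simp_all add: artanh_coeff_def power2_eq_square algebra_simps)
  also have "\<dots> \<le> 5 / 2" using odd_sum[of n] by (rule order_trans) simp
  finally show ?thesis .
qed

lemma summable_artanh_coeff_power:
  fixes x :: real
  assumes "\<bar>x\<bar> < 1"
  shows "summable (\<lambda>m. artanh_coeff m * real m ^ j * x ^ m)"
  using assms
proof (induction j arbitrary: x)
  case 0
  show ?case
  proof (rule summable_comparison_test')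
    show "summable (\<lambda>m. 2 * \<bar>x\<bar> ^ m)" using 0 by (intro summable_mult summable_geometric) auto
    show "norm (artanh_coeff m * real m ^ 0 * x ^ m) \<le> 2 * \<bar>x\<bar> ^ m" if "0 \<le> m" for m
    proof -
      have "artanh_coeff m \<le> 2"
        by (auto simp: artanh_coeff_def divide_simps elim!: oddE)
      thus ?thesis by (simp add: abs_mult power_abs mult_right_mono)
    qed
  qed
next
  case (Suc j)
  have "summable (\<lambda>m. diffs (\<lambda>m. artanh_coeff m * real m ^ j) m * x ^ m)"
    by (rule termdiff_converges[of x 1]) (use Suc in auto)
  hence "summable (\<lambda>m. x * (diffs (\<lambda>m. artanh_coeff m * real m ^ j) m * x ^ m))"
    by (rule summable_mult)
  hence "summable (\<lambda>m. artanh_coeff (Suc m) * real (Suc m) ^ Suc j * x ^ Suc m)"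
    by (simp add: diffs_def mult_ac)
  thus ?case by (subst (asm) summable_Suc_iff)
qed

text \<open>The operator \<open>x d/dx\<close> applied \<open>j\<close> times to
  \<open>2 artanh x = ln ((1 + x) / (1 - x))\<close>.\<close>

definition artanh_moment :: "nat \<Rightarrow> real \<Rightarrow> real" where
  "artanh_moment j x = (\<Sum>m. artanh_coeff m * real m ^ j * x ^ m)"

lemma artanh_moment_sums:
  assumes "\<bar>x\<bar> < 1"
  shows "(\<lambda>m. artanh_coeff m * real m ^ j * x ^ m) sums artanh_moment j x"
  unfolding artanh_moment_def using summable_artanh_coeff_power[OF assms] by (rule summable_sums)

lemma artanh_coeff_sums:
  assumes z: "norm (z :: complex) < 1"
  shows "(\<lambda>m. of_real (artanh_coeff m) * z ^ m) sums (Ln (1 + z) - Ln (1 - z))"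
proof -
  have "(\<lambda>m. - ((- z) ^ m) / of_nat m - (- (z ^ m) / of_nat m)) sums (Ln (1 + z) - Ln (1 - z))"
    using sums_diff[OF Ln_series'[of z] Ln_series'[of "- z"]] z by simp
  also have "(\<lambda>m. - ((- z) ^ m) / of_nat m - (- (z ^ m) / of_nat m)) =
      (\<lambda>m. of_real (artanh_coeff m) * z ^ m)"
    by (auto simp: artanh_coeff_def fun_eq_iff)
  finally show ?thesis .
qed

text \<open>A difference of two principal logarithms: for \<open>z\<close> in the unit disc both
  arguments lie in the right half plane, so each logarithm has its power series there.\<close>

definition two_artanh :: "complex \<Rightarrow> complex" where
  "two_artanh z = Ln (1 + z) - Ln (1 - z)"

lemma exp_two_artanh:
  assumes "norm z < 1"
  shows "exp (two_artanh z) = (1 + z) / (1 - z)"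
proof -
  have "1 + z \<noteq> 0" "1 - z \<noteq> 0"
    using assms by (auto simp: add_eq_0_iff)
  thus ?thesis by (simp add: two_artanh_def exp_diff)
qed

lemma two_artanh_of_real:
  assumes "\<bar>x\<bar> < 1"
  shows "two_artanh (of_real x) = of_real (artanh_moment 0 x)"
proof -
  have "(\<lambda>m. complex_of_real (artanh_coeff m * real m ^ 0 * x ^ m)) sums of_real (artanh_moment 0 x)"
    using artanh_moment_sums[OF assms] by (rule sums_of_real)
  with artanh_coeff_sums[of "of_real x"] assms show ?thesis
    unfolding two_artanh_def by (intro sums_unique2) auto
qed

text \<open>The factor \<open>m\<close> cancels the denominator of the coefficient and leaves a
  geometric series in \<open>x\<^sup>2\<close>. The closed form later gives continuity of the
  function in the saddle point equation.\<close>

lemma artanh_moment_1: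
  assumes "\<bar>x\<bar> < 1"
  shows "artanh_moment 1 x = 2 * x / (1 - x\<^sup>2)"
proof -
  have *: "(\<lambda>j. 2 * x * (x\<^sup>2) ^ j) sums (2 * x * (1 / (1 - x\<^sup>2)))"
    using assms by (intro sums_mult geometric_sums) (simp add: abs_square_less_1)
  hence "(\<lambda>j. artanh_coeff (2 * j + 1) * real (2 * j + 1) ^ 1 * x ^ (2 * j + 1)) sums (2 * x / (1 - x\<^sup>2))"
  proof -
    have "artanh_coeff (2 * j + 1) * real (2 * j + 1) ^ 1 = 2" for j
      by (simp add: artanh_coeff_def field_simps)
    hence "artanh_coeff (2 * j + 1) * real (2 * j + 1) ^ 1 * x ^ (2 * j + 1) = 2 * x * (x\<^sup>2) ^ j" for j
      by (simp add: power_mult)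
    with * show ?thesis by (simp only: times_divide_eq_right mult_1_right)
  qed
  hence "(\<lambda>m. artanh_coeff m * real m ^ 1 * x ^ m) sums (2 * x / (1 - x\<^sup>2))"
  proof (subst (asm) sums_mono_reindex)
    show "strict_mono (\<lambda>j :: nat. 2 * j + 1)" by (rule strict_monoI) simp
    show "artanh_coeff m * real m ^ 1 * x ^ m = 0" if "m \<notin> range (\<lambda>j. 2 * j + 1)" for m
    proof -
      have "even m" using that by (metis oddE rangeI)
      thus ?thesis by (simp add: artanh_coeff_def)
    qed
  qed
  thus ?thesis using artanh_moment_sums[OF assms, of 1] by (rule sums_unique2[symmetric])
qed

lemma one_minus_cos_le: "1 - cos (t :: real) \<le> t\<^sup>2 / 2"
proof -
  have "\<bar>sin (t / 2)\<bar>\<^sup>2 \<le> \<bar>t / 2\<bar>\<^sup>2"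
    by (intro power_mono abs_sin_x_le_abs_x) auto
  moreover have "cos t = 1 - 2 * (sin (t / 2))\<^sup>2"
    using cos_double_sin[of "t / 2"] by simp
  ultimately show ?thesis by (simp add: power_divide)
qed

lemma abs_diff_sin_le: "\<bar>t - sin (t :: real)\<bar> \<le> \<bar>t\<bar> ^ 3 / 6"
proof -
  have "\<bar>sin t - (\<Sum>m<3. sin_coeff m * t ^ m)\<bar> \<le> inverse (fact 3) * \<bar>t\<bar> ^ 3"
    by (rule Maclaurin_sin_bound)
  thus ?thesis by (simp add: sin_coeff_def eval_nat_numeral abs_minus_commute field_simps)
qed

text \<open>One power of \<open>u\<close> is traded for half of the exponent; this brings the third
  moment down to the second.\<close>

lemma exp_neg_times_le:
  assumes "0 \<le> (u :: real)"
  shows "u * exp (- u) \<le> exp (- u / 2)"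
proof -
  have "1 + u / 2 + (u / 2)\<^sup>2 / 2 \<le> exp (u / 2)"
    using assms by (intro exp_lower_Taylor_quadratic) auto
  moreover have "0 \<le> (u / 2 - 1)\<^sup>2" by simp
  ultimately have "u \<le> exp (u / 2)"
    by (simp add: power2_eq_square algebra_simps)
  hence "u * exp (- u) \<le> exp (u / 2) * exp (- u)"
    by (rule mult_right_mono) simp
  thus ?thesis by (simp flip: exp_add)
qed

section \<open>Variation of \<open>2 artanh\<close> along a circle\<close>

context
  fixes x \<theta> :: real
  assumes x: "0 \<le> x" "x < 1"
begin

lemma two_artanh_diff_sums:
  "(\<lambda>m. of_real (artanh_coeff m * x ^ m) * (cis (- (real m * \<theta>)) - 1)) sums
     (two_artanh (of_real x * cis (- \<theta>)) - two_artanh (of_real x))"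
proof -
  have "(\<lambda>m. of_real (artanh_coeff m) * (of_real x * cis (- \<theta>)) ^ m - of_real (artanh_coeff m) * of_real x ^ m)
      sums (two_artanh (of_real x * cis (- \<theta>)) - two_artanh (of_real x))"
    unfolding two_artanh_def using x by (intro sums_diff artanh_coeff_sums) (simp_all add: norm_mult)
  thus ?thesis
    by (simp add: power_mult_distrib Complex.DeMoivre algebra_simps)
qed

lemma Re_two_artanh_diff_sums:
  "(\<lambda>m. artanh_coeff m * x ^ m * (1 - cos (real m * \<theta>))) sums
     (- Re (two_artanh (of_real x * cis (- \<theta>)) - two_artanh (of_real x)))"
  using sums_minus[OF sums_Re[OF two_artanh_diff_sums]] by (simp add: algebra_simps)

text \<open>Adding \<open>\<theta> * artanh_moment 1 x\<close> removes the linear part of the phase,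
  so every term is of third order in \<open>\<theta>\<close>.\<close>

lemma Im_two_artanh_diff_sums:
  "(\<lambda>m. artanh_coeff m * x ^ m * (real m * \<theta> - sin (real m * \<theta>))) sums
     (Im (two_artanh (of_real x * cis (- \<theta>)) - two_artanh (of_real x)) + \<theta> * artanh_moment 1 x)"
proof -
  have "(\<lambda>m. artanh_coeff m * real m ^ 1 * x ^ m) sums artanh_moment 1 x"
    using x by (intro artanh_moment_sums) auto
  from sums_add[OF sums_Im[OF two_artanh_diff_sums] sums_mult[OF this, of \<theta>]]
  show ?thesis by (simp add: algebra_simps)
qed

text \<open>All terms of the series are nonnegative after the sign change; only \<open>m = 1\<close>
  is kept. This replaces the constant pi^2/4 by 2 in the decay of the integrand.\<close>

lemma Re_two_artanh_diff_le:
  "Re (two_artanh (of_real x * cis (- \<theta>)) - two_artanh (of_real x)) \<le> - 2 * x * (1 - cos \<theta>)"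
proof -
  have "2 * x * (1 - cos \<theta>) \<le> - Re (two_artanh (of_real x * cis (- \<theta>)) - two_artanh (of_real x))"
  proof (rule sums_le[OF _ sums_single Re_two_artanh_diff_sums])
    show "(if m = 1 then 2 * x * (1 - cos \<theta>) else 0) \<le> artanh_coeff m * x ^ m * (1 - cos (real m * \<theta>))" for m
      using x by (auto simp: artanh_coeff_def)
  qed
  thus ?thesis by simp
qed

lemma Re_two_artanh_diff_ge:
  "- (\<theta>\<^sup>2 / 2) * artanh_moment 2 x \<le> Re (two_artanh (of_real x * cis (- \<theta>)) - two_artanh (of_real x))"
proof -
  have "- Re (two_artanh (of_real x * cis (- \<theta>)) - two_artanh (of_real x)) \<le> \<theta>\<^sup>2 / 2 * artanh_moment 2 x"
  proof (rule sums_le[OF _ Re_two_artanh_diff_sums sums_mult[OF artanh_moment_sums]])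
    show "artanh_coeff m * x ^ m * (1 - cos (real m * \<theta>)) \<le> \<theta>\<^sup>2 / 2 * (artanh_coeff m * real m ^ 2 * x ^ m)" for m
      using mult_left_mono[OF one_minus_cos_le[of "real m * \<theta>"], of "artanh_coeff m * x ^ m"] x
      by (simp add: power_mult_distrib mult_ac)
  qed (use x in auto)
  thus ?thesis by simp
qed

lemma abs_Im_two_artanh_diff_le:
  "\<bar>Im (two_artanh (of_real x * cis (- \<theta>)) - two_artanh (of_real x)) + \<theta> * artanh_moment 1 x\<bar>
     \<le> \<bar>\<theta>\<bar> ^ 3 / 6 * artanh_moment 3 x"
proof -
  have S: "(\<lambda>m. \<bar>\<theta>\<bar> ^ 3 / 6 * (artanh_coeff m * real m ^ 3 * x ^ m)) sums (\<bar>\<theta>\<bar> ^ 3 / 6 * artanh_moment 3 x)"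
    using x by (intro sums_mult artanh_moment_sums) auto
  have le: "\<bar>artanh_coeff m * x ^ m * (real m * \<theta> - sin (real m * \<theta>))\<bar>
      \<le> \<bar>\<theta>\<bar> ^ 3 / 6 * (artanh_coeff m * real m ^ 3 * x ^ m)" for m
  proof -
    have "artanh_coeff m * x ^ m * \<bar>real m * \<theta> - sin (real m * \<theta>)\<bar>
        \<le> artanh_coeff m * x ^ m * (\<bar>real m * \<theta>\<bar> ^ 3 / 6)"
      using x by (intro mult_left_mono abs_diff_sin_le) auto
    thus ?thesis using x by (simp add: abs_mult power_mult_distrib mult_ac)
  qed
  show ?thesis
  proof (rule abs_leI)
    show "Im (two_artanh (of_real x * cis (- \<theta>)) - two_artanh (of_real x)) + \<theta> * artanh_moment 1 x
        \<le> \<bar>\<theta>\<bar> ^ 3 / 6 * artanh_moment 3 x"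
      by (rule sums_le[OF _ Im_two_artanh_diff_sums S]) (use le[unfolded abs_le_iff] in \<open>blast+\<close>)
    show "- (Im (two_artanh (of_real x * cis (- \<theta>)) - two_artanh (of_real x)) + \<theta> * artanh_moment 1 x)
        \<le> \<bar>\<theta>\<bar> ^ 3 / 6 * artanh_moment 3 x"
      by (rule sums_le[OF _ sums_minus[OF Im_two_artanh_diff_sums] S]) (use le[unfolded abs_le_iff] in \<open>blast+\<close>)
  qed
qed

lemma artanh_moment_ge: "2 * x \<le> artanh_moment j x"
proof (rule sums_le[OF _ sums_single artanh_moment_sums])
  show "(if m = 1 then 2 * x else 0) \<le> artanh_coeff m * real m ^ j * x ^ m" for m
    using x by (auto simp: artanh_coeff_def)
qed (use x in auto)

end

section \<open>Moments of the logarithm of the product and the saddle point equation\<close>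

text \<open>With \<open>q = exp (- s)\<close>, the logarithm of \<open>\<Prod>k=1..K. (1 + q ^ k) / (1 - q ^ k)\<close> is
  \<open>log_moment K 0 s\<close>, and \<open>log_moment K j s\<close> is up to sign its \<open>j\<close>-th derivative in \<open>s\<close>.\<close>

definition log_moment :: "nat \<Rightarrow> nat \<Rightarrow> real \<Rightarrow> real" where
  "log_moment K j s = (\<Sum>k=1..K. real k ^ j * artanh_moment j (exp (- (real k * s))))"

lemma exp_neg_mult_bounds:
  assumes "0 < s" "k \<in> {1..K}"
  shows "0 \<le> exp (- (real k * s))" "exp (- (real k * s)) < 1" "\<bar>exp (- (real k * s))\<bar> < 1"
  using assms by auto

lemma log_moment_sums:
  assumes s: "0 < s"
  shows "(\<lambda>m. artanh_coeff m * real m ^ j * (\<Sum>k=1..K. real k ^ j * exp (- (real m * s)) ^ k)) sums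
           log_moment K j s"
proof -
  have "(\<lambda>m. \<Sum>k=1..K. real k ^ j * (artanh_coeff m * real m ^ j * exp (- (real k * s)) ^ m)) sums
           log_moment K j s"
    unfolding log_moment_def
    by (intro sums_sum sums_mult artanh_moment_sums) (rule exp_neg_mult_bounds[OF s])
  also have "(\<lambda>m. \<Sum>k=1..K. real k ^ j * (artanh_coeff m * real m ^ j * exp (- (real k * s)) ^ m)) =
      (\<lambda>m. artanh_coeff m * real m ^ j * (\<Sum>k=1..K. real k ^ j * exp (- (real m * s)) ^ k))"
    by (auto simp: sum_distrib_left mult_ac simp flip: exp_of_nat_mult)
  finally show ?thesis .
qed

lemma sums_le_const:
  fixes f :: "nat \<Rightarrow> real"
  assumes "f sums a" "\<And>n. (\<Sum>m<n. f m) \<le> c"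
  shows "a \<le> c"
  using assms by (metis LIMSEQ_le_const2 sums_def)

text \<open>With the sums exchanged, the sum over part sizes is taken at \<open>t = m * s\<close>.
  The resulting \<open>1 / (m * s) ^ Suc j\<close> cancels \<open>m ^ j\<close> and leaves
  \<open>artanh_coeff m / m\<close>, whose sum is at most 5/2.\<close>

lemma log_moment_le:
  assumes s: "0 < s"
    and inner: "\<And>t. 0 < t \<Longrightarrow> (\<Sum>k=1..K. real k ^ j * exp (- t) ^ k) \<le> c / t ^ Suc j"
    and c: "0 \<le> c"
  shows "log_moment K j s \<le> 5 / 2 * c / s ^ Suc j"
proof (rule sums_le_const[OF log_moment_sums[OF s]])
  fix n
  have "(\<Sum>m<n. artanh_coeff m * real m ^ j * (\<Sum>k=1..K. real k ^ j * exp (- (real m * s)) ^ k))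
      \<le> (\<Sum>m<n. c / s ^ Suc j * (artanh_coeff m / real m))"
  proof (rule sum_mono)
    fix m
    show "artanh_coeff m * real m ^ j * (\<Sum>k=1..K. real k ^ j * exp (- (real m * s)) ^ k)
        \<le> c / s ^ Suc j * (artanh_coeff m / real m)"
    proof (cases "m = 0")
      case False
      have "artanh_coeff m * real m ^ j * (\<Sum>k=1..K. real k ^ j * exp (- (real m * s)) ^ k)
          \<le> artanh_coeff m * real m ^ j * (c / (real m * s) ^ Suc j)"
        using False s by (intro mult_left_mono inner) auto
      also have "\<dots> = c / s ^ Suc j * (artanh_coeff m / real m)"
        using False s by (simp add: power_mult_distrib field_simps)
      finally show ?thesis .
    qed (simp add: artanh_coeff_def)
  qed
  also have "\<dots> = c / s ^ Suc j * (\<Sum>m<n. artanh_coeff m / real m)"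
    by (simp add: sum_distrib_left)
  also have "\<dots> \<le> c / s ^ Suc j * (5 / 2)"
    using s c by (intro mult_left_mono sum_artanh_coeff_div_le) auto
  finally show "(\<Sum>m<n. artanh_coeff m * real m ^ j * (\<Sum>k=1..K. real k ^ j * exp (- (real m * s)) ^ k))
      \<le> 5 / 2 * c / s ^ Suc j" by (simp add: mult_ac)
qed

lemma log_moment_1_le:
  assumes "0 < s"
  shows "log_moment K 1 s \<le> 5 / 2 / s\<^sup>2"
proof -
  have "log_moment K 1 s \<le> 5 / 2 * 1 / s ^ Suc 1"
    by (rule log_moment_le[OF assms]) (use sum_linear_exp_le[of _ K] in \<open>simp_all add: power2_eq_square\<close>)
  thus ?thesis by (simp add: power2_eq_square)
qed

lemma log_moment_2_le:
  assumes "0 < s"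
  shows "log_moment K 2 s \<le> 5 / s ^ 3"
proof -
  have "log_moment K 2 s \<le> 5 / 2 * 2 / s ^ Suc 2"
    by (rule log_moment_le[OF assms]) (use sum_square_exp_le[of _ K] in \<open>simp_all add: power3_eq_cube\<close>)
  thus ?thesis by (simp add: power3_eq_cube)
qed

text \<open>Applying \<open>u exp (- u) \<le> exp (- u / 2)\<close> with
  \<open>u = k * m * s\<close> bounds each term by \<open>1 / s\<close> times the corresponding term
  of the second moment at \<open>s / 2\<close>; hence \<open>40 = 5 * 2^3\<close>.\<close>

lemma log_moment_3_le:
  assumes s: "0 < s"
  shows "log_moment K 3 s \<le> 40 / s ^ 4"
proof -
  have "log_moment K 3 s \<le> 1 / s * log_moment K 2 (s / 2)"
  proof (rule sums_le[OF _ log_moment_sums[OF s] sums_mult[OF log_moment_sums]])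
    fix m
    have "real m ^ 3 * (real k ^ 3 * exp (- (real m * s)) ^ k)
        \<le> 1 / s * (real m ^ 2 * (real k ^ 2 * exp (- (real m * (s / 2))) ^ k))" for k
    proof -
      let ?u = "real k * real m * s"
      have "1 / s * real m ^ 2 * real k ^ 2 * (?u * exp (- ?u)) \<le> 1 / s * real m ^ 2 * real k ^ 2 * exp (- ?u / 2)"
        using s by (intro mult_left_mono exp_neg_times_le) auto
      moreover have "exp (- (real m * s)) ^ k = exp (- ?u)" "exp (- (real m * (s / 2))) ^ k = exp (- ?u / 2)"
        by (simp_all add: mult_ac flip: exp_of_nat_mult)
      moreover have "1 / s * real m ^ 2 * real k ^ 2 * (?u * exp (- ?u)) = real m ^ 3 * (real k ^ 3 * exp (- ?u))"
        using s by (simp add: field_simps power2_eq_square power3_eq_cube)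
      ultimately show ?thesis by (simp add: mult_ac)
    qed
    hence "(\<Sum>k=1..K. real m ^ 3 * (real k ^ 3 * exp (- (real m * s)) ^ k))
        \<le> (\<Sum>k=1..K. 1 / s * (real m ^ 2 * (real k ^ 2 * exp (- (real m * (s / 2))) ^ k)))"
      by (rule sum_mono)
    from mult_left_mono[OF this, of "artanh_coeff m"]
    show "artanh_coeff m * real m ^ 3 * (\<Sum>k=1..K. real k ^ 3 * exp (- (real m * s)) ^ k)
        \<le> 1 / s * (artanh_coeff m * real m ^ 2 * (\<Sum>k=1..K. real k ^ 2 * exp (- (real m * (s / 2))) ^ k))"
      by (simp add: sum_distrib_left mult_ac)
  qed (use s in simp)
  also have "\<dots> \<le> 1 / s * (5 / (s / 2) ^ 3)"
    using s by (intro mult_left_mono log_moment_2_le) auto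
  also have "\<dots> = 40 / s ^ 4"
    using s by (simp add: field_simps eval_nat_numeral)
  finally show ?thesis .
qed

lemma log_moment_ge:
  assumes s: "0 < s"
  shows "2 * (\<Sum>k=1..K. real k ^ j * exp (- s) ^ k) \<le> log_moment K j s"
  unfolding log_moment_def sum_distrib_left
proof (rule sum_mono)
  fix k assume k: "k \<in> {1..K}"
  have "real k ^ j * (2 * exp (- (real k * s))) \<le> real k ^ j * artanh_moment j (exp (- (real k * s)))"
    using exp_neg_mult_bounds[OF s k] by (intro mult_left_mono artanh_moment_ge) auto
  thus "2 * (real k ^ j * exp (- s) ^ k) \<le> real k ^ j * artanh_moment j (exp (- (real k * s)))"
    by (simp add: mult_ac flip: exp_of_nat_mult)
qed

lemma continuous_on_log_moment_1: "continuous_on {0<..} (log_moment K 1)"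
proof -
  have "continuous_on {0<..} (\<lambda>s. \<Sum>k=1..K. real k ^ 1 *
      (2 * exp (- (real k * s)) / (1 - (exp (- (real k * s)))\<^sup>2)))"
  proof (intro continuous_intros ballI)
    fix k s assume "k \<in> {1..K}" "s \<in> {0 :: real<..}"
    hence "(exp (- (real k * s)))\<^sup>2 < 1"
      using exp_neg_mult_bounds(3)[of s k K] by (simp only: abs_square_less_1) auto
    thus "1 - (exp (- (real k * s)))\<^sup>2 \<noteq> 0" by simp
  qed
  moreover have "log_moment K 1 s = (\<Sum>k=1..K. real k ^ 1 *
      (2 * exp (- (real k * s)) / (1 - (exp (- (real k * s)))\<^sup>2)))" if "s \<in> {0<..}" for s
    unfolding log_moment_def
  proof (intro sum.cong refl)
    fix k assume "k \<in> {1..K}"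
    hence "\<bar>exp (- (real k * s))\<bar> < 1" using that by (intro exp_neg_mult_bounds(3)) auto
    from artanh_moment_1[OF this]
    show "real k ^ 1 * artanh_moment 1 (exp (- (real k * s))) =
        real k ^ 1 * (2 * exp (- (real k * s)) / (1 - (exp (- (real k * s)))\<^sup>2))" by (simp only:)
  qed
  ultimately show ?thesis by (subst continuous_on_cong[OF refl])
qed

text \<open>Intermediate value theorem. The upper end is where the bound
  \<open>5 / 2 / s\<^sup>2\<close> equals \<open>N\<close>. At the lower end only the terms with
  \<open>m = 1\<close> and \<open>k \<le> N\<close> are kept; there
  \<open>exp (- k / N) \<ge> 1 / 3\<close>, and \<open>N (N + 1) / 3 \<ge> N\<close> because
  \<open>N \<ge> 2\<close>.\<close>

lemma saddle_point_exists:
  assumes N: "2 \<le> N"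
  obtains s where "1 / real N \<le> s" "s \<le> sqrt (5 / 2 / real N)" "log_moment (N\<^sup>2) 1 s = real N"
proof -
  define a b where "a = 1 / real N" and "b = sqrt (5 / 2 / real N)"
  have a: "0 < a" and b: "0 < b" using N by (simp_all add: a_def b_def)
  have "log_moment (N\<^sup>2) 1 b \<le> 5 / 2 / b\<^sup>2" by (rule log_moment_1_le[OF b])
  hence Mb: "log_moment (N\<^sup>2) 1 b \<le> real N" using N by (simp add: b_def)
  have "real N \<le> 2 * (\<Sum>k=1..N. real k / 3)"
  proof -
    have "(\<Sum>k=1..N. real k) = real N * (real N + 1) / 2"
      by (induction N) (auto simp: field_simps)
    moreover have "3 * real N \<le> real N * (real N + 1)" using N
      by (metis add.commute mult.commute mult_left_mono of_nat_0_le_iff of_nat_Suc of_nat_le_iff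
          of_nat_numeral Suc_le_mono numeral_3_eq_3 numeral_2_eq_2)
    ultimately show ?thesis by (simp flip: sum_divide_distrib)
  qed
  also have "\<dots> \<le> 2 * (\<Sum>k=1..N. real k ^ 1 * exp (- a) ^ k)"
  proof (intro mult_left_mono sum_mono)
    fix k assume k: "k \<in> {1..N}"
    have "exp (- 1 :: real) \<le> exp (real k * - a)"
      using k N by (simp add: a_def)
    also have "\<dots> = exp (- a) ^ k" by (rule exp_of_nat_mult)
    finally have "exp (- 1 :: real) \<le> exp (- a) ^ k" .
    moreover have "1 / 3 \<le> exp (- 1 :: real)"
      using exp_le by (simp add: exp_minus field_simps)
    ultimately have "1 / 3 \<le> exp (- a) ^ k" by (rule order_trans[rotated])
    from mult_left_mono[OF this, of "real k"]
    show "real k / 3 \<le> real k ^ 1 * exp (- a) ^ k" by simp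
  qed simp
  also have "\<dots> \<le> 2 * (\<Sum>k=1..N\<^sup>2. real k ^ 1 * exp (- a) ^ k)"
    using N by (intro mult_left_mono sum_mono2) (auto simp: power2_eq_square intro: order_trans)
  also have "\<dots> \<le> log_moment (N\<^sup>2) 1 a" by (rule log_moment_ge[OF a])
  finally have Ma: "real N \<le> log_moment (N\<^sup>2) 1 a" .
  have ab: "a \<le> b"
  proof (rule power2_le_imp_le)
    show "a\<^sup>2 \<le> b\<^sup>2" using N by (simp add: a_def b_def field_simps power2_eq_square)
  qed (use b in simp)
  have "\<exists>s\<ge>a. s \<le> b \<and> log_moment (N\<^sup>2) 1 s = real N"
    using a by (intro IVT2' Ma Mb ab continuous_on_subset[OF continuous_on_log_moment_1]) auto
  with that show thesis unfolding a_def b_def by blast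
qed

section \<open>Lower bounds for the cosine sums that govern the decay on the circle\<close>

lemma sums_power_one_minus_cos:
  fixes q y :: real
  assumes q: "0 < q" "q < 1"
  shows "(\<lambda>k. q ^ k * (1 - cos (real k * y))) sums
           (q * (1 + q) * (1 - cos y) / ((1 - q) * ((1 - q)\<^sup>2 + 2 * q * (1 - cos y))))"
proof -
  define z where "z = of_real q * cis y"
  have z: "norm z < 1" using q by (simp add: z_def norm_mult)
  have D: "0 < (1 - q)\<^sup>2 + 2 * q * (1 - cos y)"
    using q by (intro add_pos_nonneg mult_nonneg_nonneg) auto
  have norm2: "(cmod (1 - z))\<^sup>2 = (1 - q)\<^sup>2 + 2 * q * (1 - cos y)"
  proof -
    have "(cmod (1 - z))\<^sup>2 = (1 - q * cos y)\<^sup>2 + q\<^sup>2 * (sin y)\<^sup>2"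
      by (simp add: z_def cmod_power2 power_mult_distrib)
    also have "\<dots> = (1 - q)\<^sup>2 + 2 * q * (1 - cos y)"
      unfolding sin_squared_eq by (simp add: power2_eq_square algebra_simps)
    finally show ?thesis .
  qed
  have "(\<lambda>k. q ^ k * cos (real k * y)) sums Re (1 / (1 - z))"
    using sums_Re[OF geometric_sums[OF z]] unfolding z_def
    by (simp add: power_mult_distrib Complex.DeMoivre flip: of_real_power)
  moreover have "Re (1 / (1 - z)) = (1 - q * cos y) / ((1 - q)\<^sup>2 + 2 * q * (1 - cos y))"
    unfolding norm2[symmetric] by (simp add: Re_divide' z_def)
  ultimately have "(\<lambda>k. q ^ k - q ^ k * cos (real k * y)) sums
      (1 / (1 - q) - (1 - q * cos y) / ((1 - q)\<^sup>2 + 2 * q * (1 - cos y)))"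
    using q by (intro sums_diff geometric_sums) auto
  moreover have "1 / (1 - q) - (1 - q * cos y) / ((1 - q)\<^sup>2 + 2 * q * (1 - cos y))
      = q * (1 + q) * (1 - cos y) / ((1 - q) * ((1 - q)\<^sup>2 + 2 * q * (1 - cos y)))"
    using q D by (simp add: divide_simps) (simp add: power2_eq_square algebra_simps)
  ultimately show ?thesis by (simp add: right_diff_distrib)
qed

lemma sum_power_one_minus_cos_ge:
  fixes q y :: real
  assumes q: "0 < q" "q < 1"
  shows "q * (1 + q) * (1 - cos y) / ((1 - q) * ((1 - q)\<^sup>2 + 2 * q * (1 - cos y))) - 2 * q ^ Suc K / (1 - q)
           \<le> (\<Sum>k=1..K. q ^ k * (1 - cos (real k * y)))" (is "?E - _ \<le> _")
proof -
  have lhs: "(\<lambda>k. q ^ (k + Suc K) * (1 - cos (real (k + Suc K) * y))) sums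
      (?E - (\<Sum>k<Suc K. q ^ k * (1 - cos (real k * y))))"
    using sums_power_one_minus_cos[OF q] by (rule sums_split_initial_segment)
  have rhs: "(\<lambda>k. 2 * q ^ Suc K * q ^ k) sums (2 * q ^ Suc K * (1 / (1 - q)))"
    using q by (intro sums_mult geometric_sums) auto
  have le: "q ^ (k + Suc K) * (1 - cos (real (k + Suc K) * y)) \<le> 2 * q ^ Suc K * q ^ k" for k
  proof -
    have "1 - cos (real (k + Suc K) * y) \<le> 2"
      using cos_ge_minus_one[of "real (k + Suc K) * y"] by linarith
    hence "q ^ (k + Suc K) * (1 - cos (real (k + Suc K) * y)) \<le> q ^ (k + Suc K) * 2"
      using q by (intro mult_left_mono) auto
    thus ?thesis by (simp add: power_add mult_ac)
  qed
  have "?E - (\<Sum>k<Suc K. q ^ k * (1 - cos (real k * y))) \<le> 2 * q ^ Suc K * (1 / (1 - q))"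
    using le lhs rhs by (rule sums_le)
  moreover have "(\<Sum>k<Suc K. q ^ k * (1 - cos (real k * y))) = (\<Sum>k=1..K. q ^ k * (1 - cos (real k * y)))"
    by (simp add: lessThan_Suc_atMost sum.atMost_shift sum.atLeast1_atMost_eq)
  ultimately show ?thesis by simp
qed

text \<open>Squares \<open>sin t \<ge> t - t^3 / 6\<close> at \<open>t = \<bar>y\<bar> / 2\<close>;
  the hypothesis is what makes the right-hand side nonnegative.\<close>

lemma one_minus_cos_ge_quartic:
  assumes "y\<^sup>2 \<le> 24"
  shows "y\<^sup>2 / 2 * (1 - y\<^sup>2 / 12) \<le> 1 - cos (y :: real)"
proof -
  define t where "t = \<bar>y\<bar> / 2"
  have t: "0 \<le> t" "t\<^sup>2 \<le> 6" "y\<^sup>2 = 4 * t\<^sup>2" using assms by (simp_all add: t_def power_divide)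
  have "t - t ^ 3 / 6 \<le> sin t" using abs_le_D1[OF abs_diff_sin_le[of t]] t(1) by simp
  hence "t * (1 - t\<^sup>2 / 6) \<le> sin t" by (simp add: algebra_simps power2_eq_square power3_eq_cube)
  hence "(t * (1 - t\<^sup>2 / 6))\<^sup>2 \<le> (sin t)\<^sup>2"
    using t by (intro power_mono mult_nonneg_nonneg) auto
  moreover have "1 - t\<^sup>2 / 3 \<le> (1 - t\<^sup>2 / 6)\<^sup>2"
    using zero_le_power2[of "t\<^sup>2"] by (simp add: power2_eq_square algebra_simps)
  hence "t\<^sup>2 * (1 - t\<^sup>2 / 3) \<le> (t * (1 - t\<^sup>2 / 6))\<^sup>2"
    unfolding power_mult_distrib by (intro mult_left_mono) auto
  moreover have "1 - cos y = 2 * (sin t)\<^sup>2"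
    using cos_double_sin[of t] by (simp add: t_def)
  ultimately show ?thesis using t(3) by simp
qed

section \<open>The saddle point\<close>

text \<open>The exponent \<open>10\<close> makes all powers of \<open>s\<close> occurring below integral powers of \<open>\<delta>\<close>.\<close>

locale saddle =
  fixes N :: nat and \<delta> s :: real
  assumes \<delta>_pos: "0 < \<delta>" and \<delta>_le: "\<delta> \<le> 1 / 10 ^ 10" and s_eq: "s = \<delta> ^ 10"
    and sN: "1 \<le> s * real N" and saddle_eq: "log_moment (N\<^sup>2) 1 s = real N"
begin

lemma s_pos: "0 < s"
  using \<delta>_pos by (simp add: s_eq)

lemma s_le: "s \<le> 1 / 10 ^ 100"
proof -
  have "\<delta> ^ 10 \<le> (1 / 10 ^ 10) ^ 10"
    using \<delta>_pos \<delta>_le by (intro power_mono) auto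
  thus ?thesis by (simp add: s_eq power_divide)
qed

lemma N_ge: "10 ^ 100 \<le> real N"
proof -
  have "s * 10 ^ 100 \<le> 1" using s_le by simp
  also have "\<dots> \<le> s * real N" by (rule sN)
  finally show ?thesis using s_pos by simp
qed

definition q :: real where "q = exp (- s)"

lemma q_pos: "0 < q" and q_less_1: "q < 1"
  using s_pos by (simp_all add: q_def)

lemma q_ge: "1 - s \<le> q"
  unfolding q_def using exp_ge_add_one_self[of "- s"] by simp

lemma one_minus_q_le: "1 - q \<le> s" using q_ge by simp

lemma one_minus_q_ge: "s / 2 \<le> 1 - q"
proof -
  have "exp (- s) \<le> inverse (1 + s)"
    unfolding exp_minus using s_pos exp_ge_add_one_self[of s] by (intro le_imp_inverse_le) auto
  moreover have "inverse (1 + s) \<le> 1 - s / 2"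
    using s_pos s_le by (simp add: field_simps)
  ultimately show ?thesis by (simp add: q_def)
qed

text \<open>Twice the tail that the cut at \<open>N\<^sup>2\<close> removes from the geometric
  cosine sum. It is negligible because
  \<open>q ^ (N\<^sup>2) = exp (- s N * N) \<le> exp (- N)\<close> while
  \<open>1 / (1 - q) \<le> 2 N\<close>.\<close>

lemma truncation_le: "4 * q ^ Suc (N\<^sup>2) / (1 - q) \<le> 1 / 200"
proof -
  have N: "0 < real N" using N_ge by simp
  have "q ^ Suc (N\<^sup>2) \<le> q ^ (N\<^sup>2)"
    using q_pos q_less_1 by (intro power_decreasing) auto
  also have "\<dots> = exp (- (s * real N * real N))"
    unfolding q_def exp_of_nat_mult[symmetric] by (simp add: power2_eq_square mult_ac)
  also have "\<dots> \<le> exp (- real N)"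
    using mult_right_mono[OF sN, of "real N"] by simp
  also have "\<dots> \<le> 2 / (real N)\<^sup>2"
  proof -
    have "(real N)\<^sup>2 / 2 \<le> exp (real N)"
      using exp_lower_Taylor_quadratic[of "real N"] N by linarith
    thus ?thesis using N by (simp add: exp_minus field_simps)
  qed
  finally have "q ^ Suc (N\<^sup>2) \<le> 2 / (real N)\<^sup>2" .
  moreover have "1 / (1 - q) \<le> 2 * real N"
  proof -
    have "1 / (1 - q) \<le> 1 / (s / 2)"
      using one_minus_q_ge s_pos by (intro divide_left_mono mult_pos_pos) auto
    also have "\<dots> \<le> 2 * real N" using sN s_pos by (simp add: field_simps)
    finally show ?thesis .
  qed
  ultimately have "4 * (q ^ Suc (N\<^sup>2) * (1 / (1 - q))) \<le> 4 * (2 / (real N)\<^sup>2 * (2 * real N))"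
    using q_pos q_less_1 N by (intro mult_left_mono mult_mono) auto
  also have "\<dots> = 16 / real N" using N by (simp add: power2_eq_square)
  also have "\<dots> \<le> 1 / 200" using N_ge by (simp add: field_simps)
  finally show ?thesis by simp
qed

text \<open>The split is on whether \<open>2 q (1 - cos y)\<close> exceeds a hundredth of
  \<open>(1 - q)\<^sup>2\<close>. If not, \<open>y\<close> is small, the denominator is at most
  \<open>101 / 100 * s ^ 3\<close> and the quotient is close to \<open>2 y\<^sup>2 / s ^ 3\<close>.
  If it does, \<open>1 - cos y\<close> cancels up to a constant and an amount of order
  \<open>1 / s\<close> remains.\<close>

lemma sum_power_one_minus_cos_lower:
  assumes y: "\<bar>y\<bar> \<le> pi"
  shows "195 / 100 * y\<^sup>2 / s ^ 3 \<le> 2 * (q * (1 + q) * (1 - cos y) / ((1 - q) * ((1 - q)\<^sup>2 + 2 * q * (1 - cos y))))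
    \<or> 1 / (100 * s) \<le> 2 * (q * (1 + q) * (1 - cos y) / ((1 - q) * ((1 - q)\<^sup>2 + 2 * q * (1 - cos y))))"
proof -
  define u e where "u = 1 - cos y" and "e = 1 - q"
  have e: "0 < e" "e \<le> s" using q_less_1 one_minus_q_le by (auto simp: e_def)
  have q9: "999 / 1000 \<le> q" using q_ge s_le by simp
  have u: "0 \<le> u" by (simp add: u_def)
  have D: "0 < e\<^sup>2 + 2 * q * u" using e u q_pos by (intro add_pos_nonneg) auto
  show ?thesis
  proof (cases "2 * q * u \<le> e\<^sup>2 / 100")
    case True
    have "u \<le> 1 / 10 ^ 4"
    proof -
      have "2 * (999 / 1000) * u \<le> 2 * q * u" using q9 u by (intro mult_right_mono) auto
      moreover have "e\<^sup>2 \<le> 1 / 10 ^ 4" using e s_le power_mono[of e "1 / 10 ^ 2" 2]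
        by (simp add: power_divide)
      ultimately show ?thesis using True u by simp
    qed
    have y_small: "y\<^sup>2 \<le> 1 / 100"
    proof -
      have "y\<^sup>2 \<le> pi\<^sup>2" using power_mono[OF y, of 2] by simp
      also have "\<dots> \<le> (316 / 100)\<^sup>2" using pi_approx by (intro power_mono) auto
      finally have "y\<^sup>2 \<le> 10" by (simp add: power2_eq_square)
      hence "y\<^sup>2 / 2 * (1 / 6) \<le> y\<^sup>2 / 2 * (1 - y\<^sup>2 / 12)"
        by (intro mult_left_mono) auto
      also have "\<dots> \<le> u" unfolding u_def using \<open>y\<^sup>2 \<le> 10\<close> by (intro one_minus_cos_ge_quartic) auto
      finally show ?thesis using \<open>u \<le> 1 / 10 ^ 4\<close> by simp
    qed
    have u_ge: "999 / 1000 * (y\<^sup>2 / 2) \<le> u"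
    proof -
      have "y\<^sup>2 / 2 * (999 / 1000) \<le> y\<^sup>2 / 2 * (1 - y\<^sup>2 / 12)"
        using y_small by (intro mult_left_mono) auto
      also have "\<dots> \<le> u" unfolding u_def using y_small by (intro one_minus_cos_ge_quartic) auto
      finally show ?thesis by simp
    qed
    have "195 / 100 * y\<^sup>2 / s ^ 3 \<le> 2 * (999 / 1000 * (1 + 999 / 1000) * (999 / 1000 * (y\<^sup>2 / 2))) / (101 / 100 * s ^ 3)"
      using s_pos by (simp add: field_simps)
    also have "\<dots> \<le> 2 * (q * (1 + q) * u) / (e * (e\<^sup>2 + 2 * q * u))"
    proof (rule frac_le)
      show "2 * (999 / 1000 * (1 + 999 / 1000) * (999 / 1000 * (y\<^sup>2 / 2))) \<le> 2 * (q * (1 + q) * u)"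
        using q9 u u_ge by (intro mult_left_mono mult_mono) auto
      have "e * (e\<^sup>2 + 2 * q * u) \<le> e * (101 / 100 * e\<^sup>2)"
        using True e by (intro mult_left_mono) auto
      also have "\<dots> = 101 / 100 * e ^ 3" by (simp add: power2_eq_square power3_eq_cube)
      also have "\<dots> \<le> 101 / 100 * s ^ 3" using e by (intro mult_left_mono power_mono) auto
      finally show "e * (e\<^sup>2 + 2 * q * u) \<le> 101 / 100 * s ^ 3" .
    qed (use e D q_pos u in auto)
    finally show ?thesis by (simp add: u_def e_def)
  next
    case False
    have "1 / (100 * s) \<le> 1 / (100 * e)" using e by (intro divide_left_mono) auto
    also have "\<dots> \<le> 2 * (q * (1 + q) * u) / (e * (e\<^sup>2 + 2 * q * u))"
    proof -
      have "e\<^sup>2 + 2 * q * u \<le> 101 * (2 * q * u)" using False by linarith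
      also have "\<dots> = 200 * (q * (101 / 100) * u)" by simp
      also have "\<dots> \<le> 200 * (q * (1 + q) * u)"
        using q_pos u q9 by (intro mult_left_mono mult_right_mono) auto
      finally have "e\<^sup>2 + 2 * q * u \<le> 200 * (q * (1 + q) * u)" .
      hence "(e\<^sup>2 + 2 * q * u) / 100 / (e * (e\<^sup>2 + 2 * q * u)) \<le> 2 * (q * (1 + q) * u) / (e * (e\<^sup>2 + 2 * q * u))"
        using e D by (intro divide_right_mono) auto
      moreover have "1 / (100 * e) = v / 100 / (e * v)" if "0 < v" for v
        using that by simp
      ultimately show ?thesis using D by metis
    qed
    finally show ?thesis by (simp add: u_def e_def)
  qed
qed

text \<open>Logarithm of the integrand for the coefficient of index \<open>N\<close>, normalised to
  vanish at \<open>y = 0\<close>. As a finite sum of logarithms of factors it involves no branch of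
  a logarithm of the whole product.\<close>

definition psi :: "real \<Rightarrow> complex" where
  "psi y = (\<Sum>k=1..N\<^sup>2. two_artanh (of_real (exp (- (real k * s))) * cis (- (real k * y)))
              - two_artanh (of_real (exp (- (real k * s))))) + \<i> * of_real (real N * y)"

lemma Re_psi: "Re (psi y) = (\<Sum>k=1..N\<^sup>2. Re (two_artanh (of_real (exp (- (real k * s))) * cis (- (real k * y)))
              - two_artanh (of_real (exp (- (real k * s))))))"
  by (simp add: psi_def)

lemma Re_psi_le_sum: "Re (psi y) \<le> - 2 * (\<Sum>k=1..N\<^sup>2. q ^ k * (1 - cos (real k * y)))"
  unfolding Re_psi sum_distrib_left
proof (rule sum_mono)
  fix k assume k: "k \<in> {1..N\<^sup>2}"
  have "q ^ k = exp (- (real k * s))" by (simp add: q_def flip: exp_of_nat_mult)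
  with Re_two_artanh_diff_le[OF exp_neg_mult_bounds(1,2)[OF s_pos k], of "real k * y"]
  show "Re (two_artanh (of_real (exp (- (real k * s))) * cis (- (real k * y)))
          - two_artanh (of_real (exp (- (real k * s))))) \<le> - 2 * (q ^ k * (1 - cos (real k * y)))"
    by simp
qed

lemma Re_psi_le:
  assumes "\<bar>y\<bar> \<le> pi"
  shows "Re (psi y) \<le> - (195 / 100 * y\<^sup>2 / s ^ 3) + 1 / 200 \<or> Re (psi y) \<le> - (1 / (100 * s)) + 1 / 200"
  using Re_psi_le_sum[of y] sum_power_one_minus_cos_ge[OF q_pos q_less_1, of y "N\<^sup>2"]
    sum_power_one_minus_cos_lower[OF assms] truncation_le by fastforce

lemma Re_psi_ge: "- (5 / 2 * y\<^sup>2 / s ^ 3) \<le> Re (psi y)"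
proof -
  have "- (y\<^sup>2 / 2) * (5 / s ^ 3) \<le> - (y\<^sup>2 / 2) * log_moment (N\<^sup>2) 2 s"
    using log_moment_2_le[OF s_pos, of "N\<^sup>2"] by (intro mult_left_mono_neg) auto
  also have "\<dots> = (\<Sum>k=1..N\<^sup>2. - ((real k * y)\<^sup>2 / 2) * artanh_moment 2 (exp (- (real k * s))))"
    unfolding log_moment_def sum_distrib_left by (intro sum.cong) (auto simp: power_mult_distrib)
  also have "\<dots> \<le> Re (psi y)"
    unfolding Re_psi by (intro sum_mono Re_two_artanh_diff_ge exp_neg_mult_bounds s_pos)
  finally show ?thesis by simp
qed

text \<open>The saddle point equation writes \<open>N\<close> as the first log moment, which cancels
  the linear phase of every factor; the third moment then gives 40/6, rounded up to 7.\<close>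

lemma abs_Im_psi_le: "\<bar>Im (psi y)\<bar> \<le> 7 * \<bar>y\<bar> ^ 3 / s ^ 4"
proof -
  have "Im (psi y) = (\<Sum>k=1..N\<^sup>2. Im (two_artanh (of_real (exp (- (real k * s))) * cis (- (real k * y)))
              - two_artanh (of_real (exp (- (real k * s))))) + (real k * y) * artanh_moment 1 (exp (- (real k * s))))"
    unfolding psi_def saddle_eq[symmetric] log_moment_def
    by (simp add: sum.distrib sum_distrib_left sum_distrib_right mult_ac)
  also have "\<bar>\<dots>\<bar> \<le> (\<Sum>k=1..N\<^sup>2. \<bar>real k * y\<bar> ^ 3 / 6 * artanh_moment 3 (exp (- (real k * s))))"
    by (intro order_trans[OF sum_abs] sum_mono abs_Im_two_artanh_diff_le exp_neg_mult_bounds s_pos)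
  also have "\<dots> = \<bar>y\<bar> ^ 3 / 6 * log_moment (N\<^sup>2) 3 s"
    unfolding log_moment_def sum_distrib_left
    by (intro sum.cong) (auto simp: abs_mult power_mult_distrib)
  also have "\<dots> \<le> \<bar>y\<bar> ^ 3 / 6 * (40 / s ^ 4)"
    by (intro mult_left_mono log_moment_3_le s_pos) auto
  also have "\<dots> \<le> 7 * \<bar>y\<bar> ^ 3 / s ^ 4"
    using s_pos by (simp add: field_simps)
  finally show ?thesis .
qed

text \<open>For \<open>x = 1 / \<delta>\<close>,
  \<open>exp x \<ge> (x / 100) ^ 100 = x ^ 60 * (x / 10 ^ 5) ^ 40\<close>, and
  \<open>x \<ge> 10 ^ 10\<close>. The power 60 lies safely beyond \<open>\<delta> ^ 45\<close>, the
  smallest main term among the integrals.\<close>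

lemma exp_neg_inverse_le:
  assumes c: "1 / 100 \<le> c"
  shows "exp (- (c / \<delta>\<^sup>2)) \<le> \<delta> ^ 60"
proof -
  define x where "x = 1 / \<delta>"
  have x: "10 ^ 10 \<le> x" using \<delta>_pos \<delta>_le by (simp add: x_def field_simps)
  have "x \<le> c * x\<^sup>2"
  proof -
    have "1 * x \<le> (c * x) * x" using x c
      by (intro mult_right_mono) (auto intro: order_trans[OF _ mult_mono[of "1/100" c "10^10" x]])
    thus ?thesis by (simp add: power2_eq_square)
  qed
  have "x ^ 60 \<le> exp x"
  proof -
    have "1 \<le> (x / 10 ^ 5) ^ 40" using x by (intro one_le_power) simp
    hence "x ^ 60 * 1 \<le> x ^ 60 * (x / 10 ^ 5) ^ 40"
      using x by (intro mult_left_mono) auto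
    also have "\<dots> = x ^ (60 + 40) / 10 ^ 200"
      unfolding power_add power_divide by (simp add: power_mult[symmetric])
    also have "\<dots> = (x / 100) ^ 100" by (simp add: power_divide)
    finally have "x ^ 60 \<le> (x / 100) ^ 100" by (simp only: mult_1_right)
    also have "\<dots> \<le> (1 + x / real 100) ^ 100" using x by (intro power_mono) auto
    also have "\<dots> \<le> exp x" using x by (intro exp_ge_one_plus_x_over_n_power_n) auto
    finally show ?thesis .
  qed
  also have "\<dots> \<le> exp (c * x\<^sup>2)" using \<open>x \<le> c * x\<^sup>2\<close> by simp
  finally have "inverse (exp (c * x\<^sup>2)) \<le> inverse (x ^ 60)"
    using x by (intro le_imp_inverse_le) auto
  thus ?thesis using \<delta>_pos by (simp add: exp_minus x_def power_divide inverse_eq_divide)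
qed

end

section \<open>The integrand between two Gaussians and its Fourier coefficients\<close>

context saddle
begin

definition G :: "real \<Rightarrow> complex" where "G y = exp (psi y)"

lemma norm_G: "norm (G y) = exp (Re (psi y))"
  by (simp add: G_def)

lemma exp_one_200th_le: "exp (1 / 200 :: real) \<le> 101 / 100"
  using exp_bound_half[of "1 / 200 :: real"] exp_bound[of "1 / 200 :: real"] by (simp add: power2_eq_square)

lemma norm_G_le:
  assumes y: "\<bar>y\<bar> \<le> pi"
  shows "norm (G y) \<le> 101 / 100 * exp (- (195 / 100 / s ^ 3) * y\<^sup>2) + 2 * \<delta> ^ 60"
proof -
  from Re_psi_le[OF y] show ?thesis
  proof
    assume "Re (psi y) \<le> - (195 / 100 * y\<^sup>2 / s ^ 3) + 1 / 200"
    hence "exp (Re (psi y)) \<le> exp (1 / 200) * exp (- (195 / 100 / s ^ 3) * y\<^sup>2)"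
      by (simp flip: exp_add)
    also have "\<dots> \<le> 101 / 100 * exp (- (195 / 100 / s ^ 3) * y\<^sup>2)"
      by (intro mult_right_mono exp_one_200th_le) auto
    finally show ?thesis using \<delta>_pos unfolding norm_G by (simp add: add_increasing2)
  next
    assume "Re (psi y) \<le> - (1 / (100 * s)) + 1 / 200"
    hence "exp (Re (psi y)) \<le> exp (1 / 200) * exp (- (1 / (100 * s)))"
      by (simp flip: exp_add)
    also have "\<dots> \<le> 2 * \<delta> ^ 60"
    proof (rule mult_mono)
      have "1 / 100 / \<delta>\<^sup>2 \<le> 1 / (100 * s)"
        using \<delta>_pos \<delta>_le unfolding s_eq
        by (simp add: field_simps power_decreasing)
      hence "exp (- (1 / (100 * s))) \<le> exp (- (1 / 100 / \<delta>\<^sup>2))" by simp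
      also have "\<dots> \<le> \<delta> ^ 60" by (rule exp_neg_inverse_le) simp
      finally show "exp (- (1 / (100 * s))) \<le> \<delta> ^ 60" .
    qed (use exp_one_200th_le in auto)
    finally show ?thesis unfolding norm_G by (simp add: add_increasing)
  qed
qed

text \<open>The Gaussians have width of order \<open>s^(3/2) = \<delta> ^ 15\<close>, and the cut at
  \<open>\<delta> ^ 14\<close> is \<open>1 / \<delta>\<close> widths away. Inside, the phase is at
  most \<open>7 \<delta>\<^sup>2\<close>, so its cosine is nearly 1; outside,
  \<open>y\<^sup>2 / s ^ 3 \<ge> 1 / \<delta>\<^sup>2\<close> makes everything of order
  \<open>\<delta> ^ 60\<close>.\<close>

lemma Re_G_ge:
  assumes y: "\<bar>y\<bar> \<le> pi"
  shows "99 / 100 * exp (- (5 / 2 / s ^ 3) * y\<^sup>2) - 5 * \<delta> ^ 60 \<le> Re (G y)"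
proof (cases "\<bar>y\<bar> \<le> \<delta> ^ 14")
  case True
  have "\<bar>y\<bar> ^ 3 \<le> (\<delta> ^ 14) ^ 3" using True by (intro power_mono) auto
  hence "7 * \<bar>y\<bar> ^ 3 / s ^ 4 \<le> 7 * (\<delta> ^ 14) ^ 3 / s ^ 4"
    using s_pos by (intro divide_right_mono mult_left_mono) auto
  also have "\<dots> = 7 * \<delta>\<^sup>2"
    using \<delta>_pos by (simp add: s_eq field_simps flip: power_mult power_add)
  also have "\<dots> \<le> 1 / 10"
    using \<delta>_pos power_mono[OF \<delta>_le, of 2] by (simp add: power_divide)
  finally have Im: "\<bar>Im (psi y)\<bar> \<le> 1 / 10" using abs_Im_psi_le[of y] by linarith
  have "\<bar>Im (psi y)\<bar>\<^sup>2 \<le> (1 / 10)\<^sup>2" using Im by (intro power_mono) auto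
  hence cos: "99 / 100 \<le> cos (Im (psi y))"
    using one_minus_cos_le[of "Im (psi y)"] by (simp add: power_divide)
  have "exp (- (5 / 2 / s ^ 3) * y\<^sup>2) * (99 / 100) \<le> exp (Re (psi y)) * cos (Im (psi y))"
    using Re_psi_ge[of y] cos by (intro mult_mono) auto
  also have "\<dots> = Re (G y)" by (simp add: G_def Re_exp)
  finally show ?thesis using zero_less_power[OF \<delta>_pos, of 60] by linarith
next
  case False
  have far: "exp (- (c / s ^ 3) * y\<^sup>2) \<le> \<delta> ^ 60" if "1 / 100 \<le> c" for c
  proof -
    have "(\<delta> ^ 14)\<^sup>2 \<le> \<bar>y\<bar>\<^sup>2" using False \<delta>_pos by (intro power_mono) auto
    hence "c / s ^ 3 * (\<delta> ^ 14)\<^sup>2 \<le> c / s ^ 3 * y\<^sup>2"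
      using that s_pos by (intro mult_left_mono) auto
    moreover have "c / s ^ 3 * (\<delta> ^ 14)\<^sup>2 = c / \<delta>\<^sup>2"
      using \<delta>_pos by (simp add: s_eq field_simps flip: power_mult power_add)
    ultimately have "exp (- (c / s ^ 3) * y\<^sup>2) \<le> exp (- (c / \<delta>\<^sup>2))" by simp
    also have "\<dots> \<le> \<delta> ^ 60" by (rule exp_neg_inverse_le[OF that])
    finally show ?thesis .
  qed
  have "- Re (G y) \<le> norm (G y)" using abs_Re_le_cmod[of "G y"] by linarith
  also have "\<dots> \<le> 101 / 100 * exp (- (195 / 100 / s ^ 3) * y\<^sup>2) + 2 * \<delta> ^ 60"
    by (rule norm_G_le[OF y])
  finally show ?thesis using far[of "195 / 100"] far[of "5 / 2"] zero_less_power[OF \<delta>_pos, of 60] by linarith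
qed

text \<open>The integral of \<open>G y * cis ((j - N) * y)\<close> over a full period; thus, for
  \<open>j \<le> N\<^sup>2\<close>, the overpartition number of \<open>j\<close> is
  \<open>P j\<close> times \<open>exp (log_moment (N\<^sup>2) 0 s + s j) / (2 pi)\<close>.\<close>

definition P :: "nat \<Rightarrow> real" where
  "P j = 2 * pi * q ^ j * real (card (bounded_overpartitions (N\<^sup>2) j)) / exp (log_moment (N\<^sup>2) 0 s)"

lemma overpartition_product_circle:
  "overpartition_product (N\<^sup>2) (of_real q * cis (- y)) =
     exp (\<Sum>k=1..N\<^sup>2. two_artanh (of_real (exp (- (real k * s))) * cis (- (real k * y))))"
proof -
  have "(1 + (of_real q * cis (- y)) ^ k) / (1 - (of_real q * cis (- y)) ^ k) =
      exp (two_artanh (of_real (exp (- (real k * s))) * cis (- (real k * y))))" if "k \<in> {1..N\<^sup>2}" for k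
  proof -
    have "(of_real q * cis (- y)) ^ k = of_real (exp (- (real k * s))) * cis (- (real k * y))"
      by (simp add: q_def power_mult_distrib Complex.DeMoivre flip: exp_of_nat_mult of_real_power)
    thus ?thesis
      using exp_neg_mult_bounds[OF s_pos that] by (simp only: exp_two_artanh norm_mult norm_cis norm_of_real abs_exp_cancel mult_1_right)
  qed
  thus ?thesis unfolding overpartition_product_def by (simp add: exp_sum)
qed

lemma G_eq: "G y = overpartition_product (N\<^sup>2) (of_real q * cis (- y)) * cis (real N * y)
                     / of_real (exp (log_moment (N\<^sup>2) 0 s))"
proof -
  have "(\<Sum>k=1..N\<^sup>2. two_artanh (of_real (exp (- (real k * s))))) = complex_of_real (log_moment (N\<^sup>2) 0 s)"
    unfolding log_moment_def of_real_sum
  proof (intro sum.cong refl)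
    fix k assume "k \<in> {1..N\<^sup>2}"
    from two_artanh_of_real[OF exp_neg_mult_bounds(3)[OF s_pos this]]
    show "two_artanh (of_real (exp (- (real k * s)))) =
        complex_of_real (real k ^ 0 * artanh_moment 0 (exp (- (real k * s))))" by simp
  qed
  hence psi: "psi y = (\<Sum>k=1..N\<^sup>2. two_artanh (of_real (exp (- (real k * s))) * cis (- (real k * y))))
      + \<i> * of_real (real N * y) - of_real (log_moment (N\<^sup>2) 0 s)"
    unfolding psi_def by (simp add: sum_subtractf)
  have "exp (\<i> * of_real (real N * y)) = cis (real N * y)" by (simp add: cis_conv_exp)
  thus ?thesis
    unfolding G_def psi exp_diff exp_add overpartition_product_circle exp_of_real by (simp only:)
qed

lemma G_coeff_has_integral:
  "((\<lambda>y. G y * cis ((real j - real N) * y)) has_integral of_real (P j)) {-pi..pi}"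
proof -
  let ?F = "overpartition_product (N\<^sup>2)"
  have "((\<lambda>y. ?F (of_real q * cis (- y)) * cis (of_nat j * y)) has_integral
      of_real (2 * pi * q ^ j) * of_nat (card (bounded_overpartitions (N\<^sup>2) j))) {-pi..pi}"
  proof (rule has_integral_power_series_coeff)
    show "summable (\<lambda>n. norm (of_nat (card (bounded_overpartitions (N\<^sup>2) n)) :: complex) * q ^ n)"
      using summable_card_bounded_overpartitions[of q "N\<^sup>2"] q_pos q_less_1 by simp
    show "(\<lambda>n. of_nat (card (bounded_overpartitions (N\<^sup>2) n)) * z ^ n) sums ?F z" if "norm z = q" for z
      using that q_less_1 by (intro sums_overpartition_product) simp
  qed (use q_pos in simp)
  from has_integral_divide[OF this, of "of_real (exp (log_moment (N\<^sup>2) 0 s))"]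
  have "((\<lambda>y. ?F (of_real q * cis (- y)) * cis (of_nat j * y) / of_real (exp (log_moment (N\<^sup>2) 0 s)))
      has_integral of_real (P j)) {-pi..pi}"
    by (simp add: P_def)
  moreover have "G y * cis ((real j - real N) * y) =
      ?F (of_real q * cis (- y)) * cis (of_nat j * y) / of_real (exp (log_moment (N\<^sup>2) 0 s))" for y
  proof -
    have "cis (real j * y) = cis (real N * y) * cis ((real j - real N) * y)"
      by (simp add: cis_mult algebra_simps)
    thus ?thesis unfolding G_eq by (simp add: mult_ac)
  qed
  ultimately show ?thesis by simp
qed

end

section \<open>Moments of the integrand\<close>

context saddle
begin

lemma \<delta>_power_le:
  assumes "m < n"
  shows "\<delta> ^ n \<le> \<delta> ^ m / 10 ^ 10"
proof -
  have "\<delta> ^ n \<le> \<delta> ^ Suc m"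
    using assms \<delta>_pos \<delta>_le by (intro power_decreasing) auto
  also have "\<dots> = \<delta> ^ m * \<delta>" by simp
  also have "\<dots> \<le> \<delta> ^ m * (1 / 10 ^ 10)"
    using \<delta>_pos \<delta>_le by (intro mult_left_mono) auto
  finally show ?thesis by simp
qed

lemma \<delta>_powers_le:
  "\<delta> ^ 30 \<le> 1 / 1000000"
  "\<delta> ^ 30 \<le> \<delta> ^ 15 / 1000000" "\<delta> ^ 45 \<le> \<delta> ^ 15 / 1000000" "\<delta> ^ 60 \<le> \<delta> ^ 15 / 1000000"
  "\<delta> ^ 60 \<le> \<delta> ^ 30 / 1000000" "\<delta> ^ 60 \<le> \<delta> ^ 45 / 1000000"
proof -
  have le: "\<delta> ^ n \<le> \<delta> ^ m / 1000000" if "m < n" for m n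
  proof (rule order_trans[OF \<delta>_power_le[OF that]])
    show "\<delta> ^ m / 10 ^ 10 \<le> \<delta> ^ m / 1000000"
      using \<delta>_pos by (intro divide_left_mono) auto
  qed
  show "\<delta> ^ 30 \<le> 1 / 1000000" using le[of 0 30] by simp
  show "\<delta> ^ 30 \<le> \<delta> ^ 15 / 1000000" "\<delta> ^ 45 \<le> \<delta> ^ 15 / 1000000" "\<delta> ^ 60 \<le> \<delta> ^ 15 / 1000000"
    "\<delta> ^ 60 \<le> \<delta> ^ 30 / 1000000" "\<delta> ^ 60 \<le> \<delta> ^ 45 / 1000000"
    by (rule le, simp)+
qed

lemma s_cubed: "s ^ 3 = \<delta> ^ 30"
  by (simp add: s_eq flip: power_mult)

lemma \<delta>_power_15_squared: "(\<delta> ^ 15)\<^sup>2 = \<delta> ^ 30"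
  by (simp flip: power_mult)

text \<open>The Gaussian integral is \<open>sqrt (2 pi / 5) * \<delta> ^ 15\<close>, a little above
  \<open>112 / 100 * \<delta> ^ 15\<close>; the factor \<open>99 / 100\<close> and the errors leave
  \<open>11 / 10\<close>.\<close>

lemma P_ge: "11 / 10 * \<delta> ^ 15 \<le> P N"
proof -
  define a where "a = 5 / 2 / s ^ 3"
  have a: "0 < a" using s_pos by (simp add: a_def)
  let ?g = "\<lambda>y. 99 / 100 * exp (- a * y\<^sup>2) - 5 * \<delta> ^ 60"
  have Re_G: "((\<lambda>y. Re (G y)) has_integral P N) {-pi..pi}"
    using has_integral_linear[OF G_coeff_has_integral[of N] bounded_linear_Re] by (simp add: o_def)
  have g: "(?g has_integral integral {-pi..pi} ?g) {-pi..pi}"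
    by (intro integrable_integral integrable_continuous_real continuous_intros)
  have "integral {-pi..pi} ?g \<le> P N"
    by (rule has_integral_le[OF g Re_G]) (use Re_G_ge in \<open>auto simp: a_def\<close>)
  moreover have "integral {-pi..pi} ?g = 99 / 100 * integral {-pi..pi} (\<lambda>y. exp (- a * y\<^sup>2)) - 10 * pi * \<delta> ^ 60"
    by (subst Henstock_Kurzweil_Integration.integral_diff)
      (auto intro!: integrable_continuous_real continuous_intros)
  moreover have "sqrt (pi / a) - 2 * exp (- a * pi\<^sup>2) / (a * pi) \<le> integral {-pi..pi} (\<lambda>y. exp (- a * y\<^sup>2))"
    by (rule gaussian_integral_lower[OF a pi_gt_zero])
  moreover have "112 / 100 * \<delta> ^ 15 \<le> sqrt (pi / a)"
  proof (rule real_le_rsqrt)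
    have "(112 / 100 * \<delta> ^ 15)\<^sup>2 = 12544 / 10000 * \<delta> ^ 30"
      by (simp add: power_mult_distrib power_divide \<delta>_power_15_squared)
    also have "\<dots> \<le> pi * (2 / 5) * \<delta> ^ 30"
      using pi_approx \<delta>_pos by (intro mult_right_mono) auto
    finally show "(112 / 100 * \<delta> ^ 15)\<^sup>2 \<le> pi / a" by (simp add: a_def s_cubed)
  qed
  moreover have "2 * exp (- a * pi\<^sup>2) / (a * pi) \<le> \<delta> ^ 30"
  proof -
    have "2 * exp (- a * pi\<^sup>2) / (a * pi) \<le> 2 * 1 / (a * 2)"
      using a pi_ge_two by (intro frac_le mult_left_mono) auto
    also have "\<dots> \<le> \<delta> ^ 30" using \<delta>_pos by (simp add: a_def s_cubed)
    finally show ?thesis .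
  qed
  moreover have "10 * pi * \<delta> ^ 60 \<le> 40 * \<delta> ^ 60"
    using pi_less_4 \<delta>_pos by (intro mult_right_mono) auto
  moreover have "\<delta> ^ 30 \<le> \<delta> ^ 15 / 10000" "\<delta> ^ 60 \<le> \<delta> ^ 15 / 10000"
    using \<delta>_powers_le zero_less_power[OF \<delta>_pos, of 15] by linarith+
  moreover have "0 < \<delta> ^ 15" using \<delta>_pos by simp
  ultimately show ?thesis by linarith
qed

lemma Re_G_cis_has_integral:
  "((\<lambda>y. Re (G y) * cos y - Im (G y) * sin y) has_integral P (N + 1)) {-pi..pi}"
  "((\<lambda>y. Re (G y) * cos y + Im (G y) * sin y) has_integral P (N - 1)) {-pi..pi}"
proof -
  have "1 \<le> N" using N_ge by (cases N) auto
  thus "((\<lambda>y. Re (G y) * cos y - Im (G y) * sin y) has_integral P (N + 1)) {-pi..pi}"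
    "((\<lambda>y. Re (G y) * cos y + Im (G y) * sin y) has_integral P (N - 1)) {-pi..pi}"
    using has_integral_linear[OF G_coeff_has_integral[of "N + 1"] bounded_linear_Re]
      has_integral_linear[OF G_coeff_has_integral[of "N - 1"] bounded_linear_Re]
    by (simp_all add: o_def of_nat_diff)
qed

text \<open>The difference is the integral of \<open>2 Im (G y) sin y\<close>, bounded through
  \<open>\<bar>G\<bar>\<close> and \<open>\<bar>y\<bar>\<close>. The constant is 2.02/1.95 rounded
  up.\<close>

lemma P_diff_le: "\<bar>P (N - 1) - P (N + 1)\<bar> \<le> 104 / 100 * \<delta> ^ 30"
proof -
  define a where "a = 195 / 100 / s ^ 3"
  have a: "0 < a" using s_pos by (simp add: a_def)
  let ?f = "\<lambda>y. (Re (G y) * cos y + Im (G y) * sin y) - (Re (G y) * cos y - Im (G y) * sin y)"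
  let ?g = "\<lambda>y :: real. 202 / 100 * (\<bar>y\<bar> * exp (- a * y\<^sup>2)) + 16 * \<delta> ^ 60"
  have f: "(?f has_integral (P (N - 1) - P (N + 1))) {-pi..pi}"
    by (intro has_integral_diff Re_G_cis_has_integral)
  have "norm (integral {-pi..pi} ?f) \<le> integral {-pi..pi} ?g"
  proof (rule integral_norm_bound_integral)
    show "?f integrable_on {-pi..pi}" using f by (rule has_integral_integrable)
    show "?g integrable_on {-pi..pi}"
      by (intro integrable_continuous_real continuous_intros)
    fix y :: real assume "y \<in> {-pi..pi}"
    hence y: "\<bar>y\<bar> \<le> pi" by auto
    have "norm (?f y) = 2 * \<bar>Im (G y)\<bar> * \<bar>sin y\<bar>" by (simp add: abs_mult)
    also have "\<dots> \<le> 2 * (101 / 100 * exp (- a * y\<^sup>2) + 2 * \<delta> ^ 60) * \<bar>y\<bar>"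
      using order_trans[OF abs_Im_le_cmod norm_G_le[OF y]] abs_sin_x_le_abs_x[of y]
      by (intro mult_mono mult_left_mono) (auto simp: a_def)
    also have "\<dots> = 202 / 100 * (\<bar>y\<bar> * exp (- a * y\<^sup>2)) + 4 * \<bar>y\<bar> * \<delta> ^ 60"
      by (simp add: algebra_simps)
    also have "4 * \<bar>y\<bar> * \<delta> ^ 60 \<le> 16 * \<delta> ^ 60"
      using y pi_less_4 \<delta>_pos by (intro mult_right_mono) auto
    finally show "norm (?f y) \<le> ?g y" by simp
  qed
  moreover have "integral {-pi..pi} ?g = 202 / 100 * integral {-pi..pi} (\<lambda>y. \<bar>y\<bar> * exp (- a * y\<^sup>2)) + 32 * pi * \<delta> ^ 60"
    by (subst Henstock_Kurzweil_Integration.integral_add)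
      (auto intro!: integrable_continuous_real continuous_intros)
  moreover have "integral {-pi..pi} (\<lambda>y. \<bar>y\<bar> * exp (- a * y\<^sup>2)) \<le> 1 / a"
    by (rule gaussian_first_moment_upper[OF a pi_ge_zero])
  moreover have "1 / a = 100 / 195 * \<delta> ^ 30" by (simp add: a_def s_cubed)
  moreover have "32 * pi * \<delta> ^ 60 \<le> 128 * \<delta> ^ 60"
    using pi_less_4 \<delta>_pos by (intro mult_right_mono) auto
  moreover have "\<delta> ^ 60 \<le> \<delta> ^ 30 / 1000000"
    using \<delta>_powers_le zero_less_power[OF \<delta>_pos, of 30] by linarith
  ultimately have "norm (integral {-pi..pi} ?f) \<le> 104 / 100 * \<delta> ^ 30"
    using zero_less_power[OF \<delta>_pos, of 30] by linarith
  thus ?thesis using integral_unique[OF f] by simp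
qed

text \<open>Here the imaginary parts cancel and \<open>2 Re (G y) (1 - cos y)\<close> remains,
  controlled by the second Gaussian moment; the constant is 1.01 * 1.27 / 3.9 rounded up.\<close>

lemma P_sum_le: "\<bar>2 * P N - (P (N + 1) + P (N - 1))\<bar> \<le> 33 / 100 * \<delta> ^ 45"
proof -
  define a where "a = 195 / 100 / s ^ 3"
  have a: "0 < a" using s_pos by (simp add: a_def)
  let ?f = "\<lambda>y. 2 * Re (G y) - ((Re (G y) * cos y - Im (G y) * sin y) + (Re (G y) * cos y + Im (G y) * sin y))"
  let ?g = "\<lambda>y :: real. 101 / 100 * (y\<^sup>2 * exp (- a * y\<^sup>2)) + 32 * \<delta> ^ 60"
  have "((\<lambda>y. Re (G y)) has_integral P N) {-pi..pi}"
    using has_integral_linear[OF G_coeff_has_integral[of N] bounded_linear_Re] by (simp add: o_def)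
  hence f: "(?f has_integral (2 * P N - (P (N + 1) + P (N - 1)))) {-pi..pi}"
    by (intro has_integral_diff has_integral_add Re_G_cis_has_integral has_integral_mult_right)
  have "norm (integral {-pi..pi} ?f) \<le> integral {-pi..pi} ?g"
  proof (rule integral_norm_bound_integral)
    show "?f integrable_on {-pi..pi}" using f by (rule has_integral_integrable)
    show "?g integrable_on {-pi..pi}"
      by (intro integrable_continuous_real continuous_intros)
    fix y :: real assume "y \<in> {-pi..pi}"
    hence y: "\<bar>y\<bar> \<le> pi" by auto
    have "?f y = 2 * (Re (G y) * (1 - cos y))" by (simp add: algebra_simps)
    hence "norm (?f y) = 2 * (\<bar>Re (G y)\<bar> * (1 - cos y))" by (simp add: abs_mult)
    also have "\<dots> \<le> 2 * ((101 / 100 * exp (- a * y\<^sup>2) + 2 * \<delta> ^ 60) * (y\<^sup>2 / 2))"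
      using order_trans[OF abs_Re_le_cmod norm_G_le[OF y]] one_minus_cos_le[of y]
      by (intro mult_mono mult_left_mono) (auto simp: a_def)
    also have "\<dots> = 101 / 100 * (y\<^sup>2 * exp (- a * y\<^sup>2)) + 2 * y\<^sup>2 * \<delta> ^ 60"
      by (simp add: algebra_simps)
    also have "2 * y\<^sup>2 * \<delta> ^ 60 \<le> 32 * \<delta> ^ 60"
    proof (intro mult_right_mono)
      have "\<bar>y\<bar>\<^sup>2 \<le> 4\<^sup>2" using y pi_less_4 by (intro power_mono) auto
      thus "2 * y\<^sup>2 \<le> 32" by simp
    qed (use \<delta>_pos in auto)
    finally show "norm (?f y) \<le> ?g y" by simp
  qed
  moreover have "integral {-pi..pi} ?g = 101 / 100 * integral {-pi..pi} (\<lambda>y. y\<^sup>2 * exp (- a * y\<^sup>2)) + 64 * pi * \<delta> ^ 60"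
    by (subst Henstock_Kurzweil_Integration.integral_add)
      (auto intro!: integrable_continuous_real continuous_intros)
  moreover have "integral {-pi..pi} (\<lambda>y. y\<^sup>2 * exp (- a * y\<^sup>2)) \<le> sqrt (pi / a) / (2 * a)"
    by (rule gaussian_second_moment_upper[OF a pi_ge_zero])
  moreover have "sqrt (pi / a) / (2 * a) \<le> 127 / 100 * (100 / 390) * \<delta> ^ 45"
  proof -
    have "sqrt (pi / a) \<le> 127 / 100 * \<delta> ^ 15"
    proof (rule real_le_lsqrt)
      have "pi / a = pi * (100 / 195) * \<delta> ^ 30" by (simp add: a_def s_cubed)
      also have "\<dots> \<le> 16129 / 10000 * \<delta> ^ 30"
        using pi_approx \<delta>_pos by (intro mult_right_mono) auto
      also have "\<dots> = (127 / 100 * \<delta> ^ 15)\<^sup>2"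
        by (simp add: power_mult_distrib power_divide \<delta>_power_15_squared)
      finally show "pi / a \<le> (127 / 100 * \<delta> ^ 15)\<^sup>2" .
    qed (use \<delta>_pos in auto)
    hence "sqrt (pi / a) / (2 * a) \<le> 127 / 100 * \<delta> ^ 15 / (2 * a)"
      using a by (intro divide_right_mono) auto
    also have "\<dots> = 127 / 100 * (100 / 390) * (\<delta> ^ 15 * \<delta> ^ 30)" by (simp add: a_def s_cubed)
    finally show ?thesis by (simp flip: power_add)
  qed
  moreover have "64 * pi * \<delta> ^ 60 \<le> 256 * \<delta> ^ 60"
    using pi_less_4 \<delta>_pos by (intro mult_right_mono) auto
  moreover have "\<delta> ^ 60 \<le> \<delta> ^ 45 / 1000000"
    using \<delta>_powers_le zero_less_power[OF \<delta>_pos, of 45] by linarith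
  ultimately have "norm (integral {-pi..pi} ?f) \<le> 33 / 100 * \<delta> ^ 45"
    using zero_less_power[OF \<delta>_pos, of 45] by linarith
  thus ?thesis using integral_unique[OF f] by simp
qed

end

section \<open>Differences of the logarithms of overpartition numbers\<close>

context saddle
begin

lemma N_le: "real N \<le> 5 / 2 / \<delta> ^ 20"
proof -
  have "s\<^sup>2 = \<delta> ^ 20" by (simp add: s_eq flip: power_mult)
  thus ?thesis using log_moment_1_le[OF s_pos, of "N\<^sup>2"] unfolding saddle_eq by (simp only:)
qed

lemma P_neighbours_ge: "\<delta> ^ 15 \<le> P (N + 1)" "\<delta> ^ 15 \<le> P (N - 1)"
proof -
  have "\<delta> ^ 30 \<le> \<delta> ^ 15 / 100" "\<delta> ^ 45 \<le> \<delta> ^ 15 / 100"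
    using \<delta>_powers_le zero_less_power[OF \<delta>_pos, of 15] by linarith+
  thus "\<delta> ^ 15 \<le> P (N + 1)" "\<delta> ^ 15 \<le> P (N - 1)"
    using P_ge P_diff_le P_sum_le zero_less_power[OF \<delta>_pos, of 15] unfolding abs_le_iff by linarith+
qed

lemma P_pos: "0 < P N" "0 < P (N + 1)" "0 < P (N - 1)"
proof -
  have "0 < \<delta> ^ 15" using \<delta>_pos by simp
  thus "0 < P N" "0 < P (N + 1)" "0 < P (N - 1)"
    using P_ge P_neighbours_ge by linarith+
qed

text \<open>Writes the product of the neighbours as a quarter of squared sum minus squared
  difference. Relative to \<open>P N\<close>, the sum loses 0.33/1.1 = 0.30 and the difference
  0.95^2/4 < 0.23, in units of \<open>\<delta> ^ 30 = s ^ 3\<close>.\<close>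

lemma P_log_concavity_defect: "1 - 53 / 100 * \<delta> ^ 30 \<le> P (N + 1) * P (N - 1) / (P N)\<^sup>2"
proof -
  define A where "A = P N"
  have A: "11 / 10 * \<delta> ^ 15 \<le> A" "0 < A" using P_ge P_pos by (simp_all add: A_def)
  have \<delta>15: "0 < \<delta> ^ 15" using \<delta>_pos by simp
  have \<delta>30: "\<delta> ^ 30 = \<delta> ^ 15 * \<delta> ^ 15" and \<delta>45: "\<delta> ^ 45 = \<delta> ^ 30 * \<delta> ^ 15"
    by (simp_all flip: power_add)
  have "33 / 100 * \<delta> ^ 45 \<le> 3 / 10 * \<delta> ^ 30 * A"
    unfolding \<delta>45 using mult_left_mono[OF A(1), of "3 / 10 * \<delta> ^ 30"] \<delta>_pos by simp
  have sum: "2 * A * (1 - 15 / 100 * \<delta> ^ 30) \<le> P (N + 1) + P (N - 1)"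
  proof -
    have "2 * A * (1 - 15 / 100 * \<delta> ^ 30) = 2 * A - 3 / 10 * \<delta> ^ 30 * A"
      by (simp add: algebra_simps)
    thus ?thesis
      using abs_le_D1[OF P_sum_le] \<open>33 / 100 * \<delta> ^ 45 \<le> 3 / 10 * \<delta> ^ 30 * A\<close> unfolding A_def by linarith
  qed
  have "104 / 100 * \<delta> ^ 30 \<le> 95 / 100 * \<delta> ^ 15 * (11 / 10 * \<delta> ^ 15)"
    unfolding \<delta>30 by simp
  also have "\<dots> \<le> 95 / 100 * \<delta> ^ 15 * A"
    using A(1) \<delta>15 by (intro mult_left_mono) auto
  finally have "104 / 100 * \<delta> ^ 30 \<le> 95 / 100 * \<delta> ^ 15 * A" .
  hence diff: "\<bar>P (N - 1) - P (N + 1)\<bar> \<le> 95 / 100 * \<delta> ^ 15 * A"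
    using P_diff_le by linarith
  have small: "\<delta> ^ 30 \<le> 1 / 100"
    using \<delta>_powers_le(1) by simp
  have "(2 * A * (1 - 15 / 100 * \<delta> ^ 30))\<^sup>2 \<le> (P (N + 1) + P (N - 1))\<^sup>2"
    using sum small A by (intro power_mono mult_nonneg_nonneg) auto
  moreover have "(P (N - 1) - P (N + 1))\<^sup>2 \<le> (95 / 100 * \<delta> ^ 15 * A)\<^sup>2"
    using diff by (metis abs_ge_zero power2_abs power_mono)
  moreover have "(1 - 53 / 100 * \<delta> ^ 30) * A\<^sup>2 \<le>
      ((2 * A * (1 - 15 / 100 * \<delta> ^ 30))\<^sup>2 - (95 / 100 * \<delta> ^ 15 * A)\<^sup>2) / 4"
  proof -
    have "(1 - 53 / 100 * \<delta> ^ 30) * A\<^sup>2 \<le>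
        ((1 - 15 / 100 * \<delta> ^ 30)\<^sup>2 - (95 / 100)\<^sup>2 * \<delta> ^ 30 / 4) * A\<^sup>2"
    proof (rule mult_right_mono)
      have "1 - 30 / 100 * \<delta> ^ 30 \<le> (1 - 15 / 100 * \<delta> ^ 30)\<^sup>2"
        by (simp add: power2_eq_square algebra_simps)
      moreover have "0 \<le> \<delta> ^ 30" using \<delta>_pos by simp
      ultimately show "1 - 53 / 100 * \<delta> ^ 30 \<le> (1 - 15 / 100 * \<delta> ^ 30)\<^sup>2 - (95 / 100)\<^sup>2 * \<delta> ^ 30 / 4"
        unfolding power2_eq_square[of "95 / 100"] by linarith
    qed simp
    also have "\<dots> = ((2 * A * (1 - 15 / 100 * \<delta> ^ 30))\<^sup>2 - (95 / 100 * \<delta> ^ 15 * A)\<^sup>2) / 4"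
      unfolding power_mult_distrib \<delta>_power_15_squared by (simp add: algebra_simps)
    finally show ?thesis .
  qed
  moreover have "P (N + 1) * P (N - 1) = ((P (N + 1) + P (N - 1))\<^sup>2 - (P (N - 1) - P (N + 1))\<^sup>2) / 4"
    by (simp add: power2_eq_square algebra_simps)
  moreover have "x \<le> y" if "a \<le> b" "c \<le> d" "x \<le> (a - d) / 4" "y = (b - c) / 4" for a b c d x y :: real
    using that by (simp add: field_simps)
  ultimately have "(1 - 53 / 100 * \<delta> ^ 30) * A\<^sup>2 \<le> P (N + 1) * P (N - 1)" by blast
  thus ?thesis using A by (simp add: A_def[symmetric] pos_le_divide_eq)
qed

definition L :: "nat \<Rightarrow> real" where
  "L j = ln (real (overpartitions j))"

lemma overpartitions_pos_and_L:
  assumes "0 < P j" "j \<le> N + 1"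
  shows "0 < overpartitions j"
    "L j = ln (P j) + log_moment (N\<^sup>2) 0 s - ln (2 * pi) + s * real j"
proof -
  have "N + 1 \<le> N\<^sup>2"
  proof -
    have "2 \<le> real N" by (rule order_trans[OF _ N_ge]) simp
    hence "2 * N \<le> N * N" "1 \<le> N" by simp_all
    thus ?thesis unfolding power2_eq_square by linarith
  qed
  hence eq: "overpartitions j = card (bounded_overpartitions (N\<^sup>2) j)"
    using assms(2) by (intro overpartitions_eq_card_bounded) auto
  show pos: "0 < overpartitions j"
    using assms(1) unfolding eq P_def by (cases "card (bounded_overpartitions (N\<^sup>2) j)") auto
  have "P j = 2 * pi * exp (- (s * real j)) * real (overpartitions j) / exp (log_moment (N\<^sup>2) 0 s)"
    unfolding P_def eq q_def by (simp add: mult_ac flip: exp_of_nat_mult)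
  hence "ln (P j) = ln (2 * pi) - s * real j + L j - log_moment (N\<^sup>2) 0 s"
    using pos by (simp add: L_def ln_div ln_mult)
  thus "L j = ln (P j) + log_moment (N\<^sup>2) 0 s - ln (2 * pi) + s * real j" by simp
qed

lemma L_eqs:
  "L (N + 1) = ln (P (N + 1)) + log_moment (N\<^sup>2) 0 s - ln (2 * pi) + s * (real N + 1)"
  "L (N - 1) = ln (P (N - 1)) + log_moment (N\<^sup>2) 0 s - ln (2 * pi) + s * (real N - 1)"
  "L N = ln (P N) + log_moment (N\<^sup>2) 0 s - ln (2 * pi) + s * real N"
proof -
  have N1: "1 \<le> N" using N_ge by (cases N) auto
  have le: "N - 1 \<le> N + 1" "N \<le> N + 1" by simp_all
  show "L (N + 1) = ln (P (N + 1)) + log_moment (N\<^sup>2) 0 s - ln (2 * pi) + s * (real N + 1)"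
    using overpartitions_pos_and_L(2)[OF P_pos(2) order_refl] by (simp only: of_nat_add of_nat_1)
  show "L (N - 1) = ln (P (N - 1)) + log_moment (N\<^sup>2) 0 s - ln (2 * pi) + s * (real N - 1)"
    using overpartitions_pos_and_L(2)[OF P_pos(3) le(1)] N1 by (simp only: of_nat_diff of_nat_1)
  show "L N = ln (P N) + log_moment (N\<^sup>2) 0 s - ln (2 * pi) + s * real N"
    by (rule overpartitions_pos_and_L(2)[OF P_pos(1) le(2)])
qed

text \<open>Keeps the terms \<open>m = 1\<close>, a truncated geometric series of total about
  \<open>1 / (1 - q) \<ge> 1 / s\<close>.\<close>

lemma log_moment_0_ge: "2 / s - 3 \<le> log_moment (N\<^sup>2) 0 s"
proof -
  have q1: "q \<noteq> 1" using q_less_1 by simp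
  have "(\<Sum>k=1..N\<^sup>2. q ^ k) = (\<Sum>k<Suc (N\<^sup>2). q ^ k) - 1"
    by (simp add: lessThan_Suc_atMost sum.atMost_shift sum.atLeast1_atMost_eq)
  also have "\<dots> = (1 - q ^ Suc (N\<^sup>2)) / (1 - q) - 1"
    using q1 by (subst sum_gp_strict) simp
  also have "\<dots> = 1 / (1 - q) - q ^ Suc (N\<^sup>2) / (1 - q) - 1" by (simp add: diff_divide_distrib)
  finally have sum: "(\<Sum>k=1..N\<^sup>2. q ^ k) = 1 / (1 - q) - q ^ Suc (N\<^sup>2) / (1 - q) - 1" .
  have "1 / s \<le> 1 / (1 - q)"
    using one_minus_q_le q_less_1 by (intro divide_left_mono) (auto intro!: mult_pos_pos s_pos)
  hence "2 * (1 / s) - 3 \<le> 2 * (\<Sum>k=1..N\<^sup>2. q ^ k)"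
    unfolding sum using truncation_le by simp
  also have "\<dots> \<le> log_moment (N\<^sup>2) 0 s"
    using log_moment_ge[OF s_pos, where K = "N\<^sup>2" and j = 0] by (simp add: q_def)
  finally show ?thesis by simp
qed

lemma neg_ln_\<delta>_power_le: "- ln (\<delta> ^ 15) \<le> 15 / \<delta>"
proof -
  have "- ln \<delta> = ln (1 / \<delta>)" using \<delta>_pos by (simp add: ln_div)
  also have "\<dots> \<le> 1 / \<delta>" using \<delta>_pos by (intro order_trans[OF ln_le_minus_one]) auto
  finally show ?thesis using \<delta>_pos by (simp add: ln_realpow)
qed

text \<open>The factor 54/53 pays for \<open>ln (1 - t)\<close> against \<open>- t\<close>; then
  \<open>N \<le> 5 / 2 / s\<^sup>2\<close> gives \<open>25 / 4 * 54 / 100 = 27 / 8\<close>.\<close>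

lemma L_second_difference_ge:
  "- (27 / (8 * s)) \<le> (real N)\<^sup>2 * (L (N + 1) + L (N - 1) - 2 * L N)"
proof -
  define t where "t = 53 / 100 * \<delta> ^ 30"
  have t: "0 \<le> t" "t \<le> 1 / 1000"
    using \<delta>_powers_le(1) \<delta>_pos by (simp_all add: t_def)
  have "- (54 / 53 * t) \<le> ln (1 - t)"
  proof -
    have "t * (t * 2) \<le> t * (1 / 53)" using t by (intro mult_left_mono) auto
    moreover have "- t - 2 * t\<^sup>2 \<le> ln (1 - t)" using t by (intro ln_one_minus_pos_lower_bound) auto
    ultimately show ?thesis by (simp add: power2_eq_square)
  qed
  also have "\<dots> \<le> ln (P (N + 1) * P (N - 1) / (P N)\<^sup>2)"
    using P_log_concavity_defect t P_pos by (subst ln_le_cancel_iff) (auto simp: t_def)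
  also have "\<dots> = L (N + 1) + L (N - 1) - 2 * L N"
    using P_pos unfolding L_eqs by (simp add: ln_div ln_mult ln_realpow algebra_simps)
  finally have "(real N)\<^sup>2 * - (54 / 53 * t) \<le> (real N)\<^sup>2 * (L (N + 1) + L (N - 1) - 2 * L N)"
    by (intro mult_left_mono) auto
  moreover have "(real N)\<^sup>2 * (54 / 53 * t) \<le> 27 / (8 * s)"
  proof -
    have "(real N)\<^sup>2 * (54 / 53 * t) \<le> (5 / 2 / \<delta> ^ 20)\<^sup>2 * (54 / 53 * t)"
      using N_le t by (intro mult_right_mono power_mono) auto
    also have "\<dots> = 27 / (8 * s)"
      using \<delta>_pos by (simp add: t_def s_eq power_divide field_simps flip: power_mult power_add)
    finally show ?thesis .
  qed
  ultimately show ?thesis by simp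
qed

text \<open>The ratio of neighbouring \<open>P\<close> values contributes only order
  \<open>1 / \<delta> ^ 5\<close>, the square root of the scale \<open>1 / s\<close>. The term
  \<open>2 s N\<close> is kept exactly, to cancel against the one in \<open>2 L N\<close>.\<close>

lemma L_first_difference_le: "real N * (L (N + 1) - L (N - 1)) \<le> 3 / \<delta> ^ 5 + 2 * s * real N"
proof -
  have "ln (P (N + 1)) - ln (P (N - 1)) = ln (P (N + 1) / P (N - 1))"
    using P_pos by (simp add: ln_div)
  also have "\<dots> \<le> P (N + 1) / P (N - 1) - 1" using P_pos by (intro ln_le_minus_one) auto
  also have "\<dots> = (P (N + 1) - P (N - 1)) / P (N - 1)" using P_pos by (simp add: field_simps)
  also have "\<dots> \<le> 104 / 100 * \<delta> ^ 30 / \<delta> ^ 15"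
    using abs_le_D2[OF P_diff_le] P_neighbours_ge(2) \<delta>_pos by (intro frac_le) auto
  also have "\<dots> = 104 / 100 * \<delta> ^ 15"
    using \<delta>_pos by (simp add: field_simps flip: power_add)
  finally have "L (N + 1) - L (N - 1) \<le> 104 / 100 * \<delta> ^ 15 + 2 * s"
    using L_eqs by (simp add: algebra_simps)
  hence "real N * (L (N + 1) - L (N - 1)) \<le> real N * (104 / 100 * \<delta> ^ 15 + 2 * s)"
    by (intro mult_left_mono) auto
  also have "\<dots> = real N * (104 / 100 * \<delta> ^ 15) + 2 * s * real N" by (simp add: algebra_simps)
  also have "real N * (104 / 100 * \<delta> ^ 15) \<le> 5 / 2 / \<delta> ^ 20 * (104 / 100 * \<delta> ^ 15)"
    using N_le \<delta>_pos by (intro mult_right_mono) auto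
  also have "\<dots> \<le> 3 / \<delta> ^ 5"
    using \<delta>_pos by (simp add: field_simps flip: power_add)
  finally show ?thesis by simp
qed

lemma L_ge: "4 / s - 11 - 30 / \<delta> + 2 * s * real N \<le> 2 * L N"
proof -
  have "ln (\<delta> ^ 15) \<le> ln (P N)"
    using P_ge zero_less_power[OF \<delta>_pos, of 15] P_pos by (subst ln_le_cancel_iff) auto
  moreover have "ln (2 * pi) \<le> 5 / 2"
  proof -
    have "ln (2 * pi) = ln 2 + ln pi" by (simp add: ln_mult)
    also have "\<dots> \<le> ln 2 + ln 4" using pi_less_4 by simp
    also have "ln (4 :: real) = 2 * ln 2" using ln_realpow[of 2 2] by simp
    finally show ?thesis using ln2_le_25_over_36 by simp
  qed
  ultimately show ?thesis
    using L_eqs(3) log_moment_0_ge neg_ln_\<delta>_power_le by simp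
qed

lemma scaled_second_difference_ge:
  "3 / (5 * s) \<le> (real N)\<^sup>2 * (L (N + 1) + L (N - 1) - 2 * L N)
                 - real N * (L (N + 1) - L (N - 1)) + 2 * L N"
proof -
  define x where "x = 1 / \<delta>"
  have x: "10 ^ 10 \<le> x" using \<delta>_pos \<delta>_le by (simp add: x_def field_simps)
  have xs: "1 / s = x ^ 10" "1 / \<delta> ^ 5 = x ^ 5" by (simp_all add: s_eq x_def power_divide)
  have "x \<le> x ^ 5" using x by (intro self_le_power) auto
  moreover have "10 ^ 4 * x ^ 5 \<le> x ^ 5 * x ^ 5"
    using x by (intro mult_right_mono order_trans[OF _ self_le_power]) auto
  hence "10 ^ 4 * x ^ 5 \<le> x ^ 10" by (simp flip: power_add)
  \<comment> \<open>All lower order terms fit into \<open>1 / (40 s)\<close>, and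
    \<open>4 - 27 / 8 - 1 / 40 = 3 / 5\<close>.\<close>
  ultimately have "3 * x ^ 5 + 11 + 30 * x \<le> x ^ 10 / 40"
    using x by simp
  thus ?thesis
    using L_second_difference_ge L_first_difference_le L_ge xs x_def by simp
qed

end

section \<open>Cubics with one real root and log-convexity\<close>

lemma real_cubic_has_root:
  fixes c0 c1 c2 c3 :: real
  assumes "0 < c3"
  obtains x where "c0 + c1 * x + c2 * x\<^sup>2 + c3 * x ^ 3 = 0"
proof -
  define p where "p = [:c0, c1, c2, c3:]"
  define p' where "p' = [:- c0, c1, - c2, c3:]"
  have p_eval: "poly p x = c0 + c1 * x + c2 * x\<^sup>2 + c3 * x ^ 3" for x
    by (simp add: p_def power2_eq_square power3_eq_cube algebra_simps)
  have p'_eval: "poly p' x = - poly p (- x)" for x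
    by (simp add: p_def p'_def algebra_simps)
  have "0 < lead_coeff p" "0 < lead_coeff p'" using assms by (simp_all add: p_def p'_def)
  then obtain u v where u: "\<And>x. u \<le> x \<Longrightarrow> 0 < poly p x" and v: "\<And>x. v \<le> x \<Longrightarrow> 0 < poly p' x"
    by (metis poly_pinfty_gt_lc less_le_trans)
  define m where "m = max 1 (max u v)"
  have "0 < poly p m" by (rule u) (simp add: m_def)
  moreover have "poly p (- m) < 0" using v[of m] by (simp add: p'_eval m_def)
  moreover have "- m < m" by (simp add: m_def)
  ultimately obtain x where "poly p x = 0" using poly_IVT_pos by blast
  with that show thesis by (simp add: p_eval)
qed

text \<open>After division by \<open>w - x\<close> the cofactor is
  \<open>a3 w\<^sup>2 + b w + c\<close>, and \<open>4 a3 c - b\<^sup>2 = 3 (a3 x + a2)\<^sup>2 + 12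
  (a1 a3 - a2\<^sup>2)\<close> is positive whichever real root \<open>x\<close> was found.\<close>

lemma cubic_roots_one_real:
  fixes a0 a1 a2 a3 :: real
  assumes a3: "0 < a3" and disc: "a2\<^sup>2 < a1 * a3"
  obtains x :: real and z :: complex where "z \<notin> \<real>"
    "{w. of_real a0 + 3 * of_real a1 * w + 3 * of_real a2 * w\<^sup>2 + of_real a3 * w ^ 3 = 0}
       = {of_real x, z, cnj z}"
proof -
  obtain x where x: "a0 + 3 * a1 * x + 3 * a2 * x\<^sup>2 + a3 * x ^ 3 = 0"
    using real_cubic_has_root[OF a3, of a0 "3 * a1" "3 * a2"] by blast
  define b c where "b = 3 * a2 + a3 * x" and "c = 3 * a1 + 3 * a2 * x + a3 * x\<^sup>2"
  define d where "d = sqrt (4 * a3 * c - b\<^sup>2) / (2 * a3)"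
  define z where "z = Complex (- b / (2 * a3)) d"
  have "4 * a3 * c - b\<^sup>2 = 3 * (a3 * x + a2)\<^sup>2 + 12 * (a1 * a3 - a2\<^sup>2)"
    by (simp add: b_def c_def power2_eq_square algebra_simps)
  hence D: "0 < 4 * a3 * c - b\<^sup>2" using disc by (simp add: add_nonneg_pos)
  hence d: "0 < d" using a3 by (simp add: d_def)
  have d2: "4 * a3\<^sup>2 * d\<^sup>2 = 4 * a3 * c - b\<^sup>2"
    using D a3 by (simp add: d_def power_divide power_mult_distrib)
  have "c = a3 * (b\<^sup>2 / (4 * a3\<^sup>2) + d\<^sup>2)"
    using d2 a3 by (simp add: field_simps power2_eq_square)
  hence c_z: "of_real c = of_real a3 * (z * cnj z)"
    unfolding complex_mult_cnj z_def by (simp add: power_divide power_mult_distrib)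
  have "z + cnj z = of_real (- b / a3)"
    unfolding complex_add_cnj using a3 by (simp add: z_def)
  hence b_z: "of_real b = - of_real a3 * (z + cnj z)" using a3 by simp
  have "of_real a0 + 3 * of_real a1 * w + 3 * of_real a2 * w\<^sup>2 + of_real a3 * w ^ 3
      = of_real a3 * (w - of_real x) * (w - z) * (w - cnj z)" for w
  proof -
    have "of_real a0 + 3 * of_real a1 * w + 3 * of_real a2 * w\<^sup>2 + of_real a3 * w ^ 3
        = of_real a0 + 3 * of_real a1 * w + 3 * of_real a2 * w\<^sup>2 + of_real a3 * w ^ 3
          - of_real (a0 + 3 * a1 * x + 3 * a2 * x\<^sup>2 + a3 * x ^ 3)"
      unfolding x by simp
    also have "\<dots> = (w - of_real x) * (of_real a3 * w\<^sup>2 + of_real b * w + of_real c)"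
      by (simp add: b_def c_def power2_eq_square power3_eq_cube algebra_simps)
    also have "\<dots> = of_real a3 * (w - of_real x) * (w - z) * (w - cnj z)"
      unfolding c_z b_z by (simp add: power2_eq_square algebra_simps)
    finally show ?thesis .
  qed
  hence "{w. of_real a0 + 3 * of_real a1 * w + 3 * of_real a2 * w\<^sup>2 + of_real a3 * w ^ 3 = 0}
       = {of_real x, z, cnj z}"
    using a3 by auto
  moreover have "z \<notin> \<real>" using d by (simp add: z_def complex_is_Real_iff)
  ultimately show thesis by (rule that[rotated])
qed

section \<open>Log-convexity of \<open>r\<close> beyond the threshold\<close>

lemma N_T_ge: "(12 + 12 * \<alpha>) ^ 227 \<le> real_of_int (N_T \<alpha>)"
proof -
  have "\<lceil>(12 + 12 * \<alpha>) ^ 227\<rceil> \<le> N2 \<alpha>" unfolding N2_def by (intro Max_ge) simp_all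
  also have "\<dots> \<le> N_T \<alpha>" unfolding N_T_def by (intro Max_ge) simp_all
  finally show ?thesis by linarith
qed

lemma ln_second_difference_le:
  assumes "1 < (x :: real)"
  shows "x\<^sup>2 * (ln (x + 1) + ln (x - 1) - 2 * ln x) - x * (ln (x + 1) - ln (x - 1)) + 2 * ln x \<le> 2 * ln x"
proof -
  have "ln (x + 1) + ln (x - 1) = ln ((x + 1) * (x - 1))" using assms by (simp add: ln_mult)
  also have "\<dots> \<le> ln (x\<^sup>2)"
    using assms less_1_mult[OF assms assms]
    by (subst ln_le_cancel_iff) (simp_all add: power2_eq_square algebra_simps)
  also have "\<dots> = 2 * ln x" using assms by (simp add: ln_realpow)
  finally have "x\<^sup>2 * (ln (x + 1) + ln (x - 1) - 2 * ln x) \<le> 0"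
    by (intro mult_nonneg_nonpos) auto
  moreover have "0 \<le> x * (ln (x + 1) - ln (x - 1))"
    using assms by (intro mult_nonneg_nonneg) auto
  ultimately show ?thesis by linarith
qed

text \<open>The \<open>n\<close>-th root divides logarithms by \<open>n\<close>; clearing the
  denominators of the second difference of \<open>a / n\<close> yields the expression bounded
  above.\<close>

lemma second_difference_of_quotients:
  fixes x a b c :: real
  assumes "x \<noteq> 0" "x + 1 \<noteq> 0" "x - 1 \<noteq> 0"
  shows "x * (x + 1) * (x - 1) * (a / (x + 1) + b / (x - 1) - 2 * (c / x)) =
           x\<^sup>2 * (a + b - 2 * c) - x * (a - b) + 2 * c"
proof -
  have "x * (x + 1) * (x - 1) * (a / (x + 1)) = x * (x - 1) * a"
    "x * (x + 1) * (x - 1) * (b / (x - 1)) = x * (x + 1) * b"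
    "x * (x + 1) * (x - 1) * (2 * (c / x)) = (x + 1) * (x - 1) * (2 * c)"
    using assms by simp_all
  hence "x * (x + 1) * (x - 1) * (a / (x + 1) + b / (x - 1) - 2 * (c / x)) =
      x * (x - 1) * a + x * (x + 1) * b - (x + 1) * (x - 1) * (2 * c)"
    by (simp only: distrib_left right_diff_distrib)
  thus ?thesis by (simp add: power2_eq_square algebra_simps)
qed

lemma r_log_convex:
  assumes \<alpha>: "0 \<le> \<alpha>" and N: "(12 + 12 * \<alpha>) ^ 227 \<le> real N"
  shows "0 < r \<alpha> (N + 1)" "(r \<alpha> N)\<^sup>2 < r \<alpha> (N - 1) * r \<alpha> (N + 1)"
proof -
  define X where "X = 12 + 12 * \<alpha>"
  have X: "12 \<le> X" "\<alpha> \<le> X / 12" using \<alpha> by (simp_all add: X_def)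
  have "(12 :: real) ^ 227 \<le> X ^ 227" using X by (intro power_mono) auto
  hence N_large: "12 ^ 227 \<le> real N" using N by (simp add: X_def)
  have N3: "3 \<le> real N" by (rule order_trans[OF _ N_large]) simp
  hence "2 \<le> N" by linarith
  then obtain s where s: "1 / real N \<le> s" "s \<le> sqrt (5 / 2 / real N)" "log_moment (N\<^sup>2) 1 s = real N"
    by (rule saddle_point_exists)
  have s_pos: "0 < s" using s(1) N3 by (intro less_le_trans[OF _ s(1)]) simp
  have s_small: "s \<le> 1 / 10 ^ 100"
  proof -
    have "5 / 2 / real N \<le> 5 / 2 / 12 ^ 227"
      using N_large N3 by (intro divide_left_mono) auto
    also have "\<dots> \<le> (1 / 10 ^ 100)\<^sup>2" by (simp add: field_simps)
    finally have "sqrt (5 / 2 / real N) \<le> 1 / 10 ^ 100" by (intro real_le_lsqrt) auto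
    with s(2) show ?thesis by linarith
  qed
  interpret saddle N "root 10 s" s
  proof
    show "0 < root 10 s" using s_pos by simp
    have "root 10 s \<le> root 10 ((1 / 10 ^ 10) ^ 10)"
      using s_small by (simp add: power_divide flip: power_mult)
    thus "root 10 s \<le> 1 / 10 ^ 10" by (simp only: real_root_power_cancel zero_le_divide_1_iff zero_le_power zero_le_numeral zero_less_numeral)
    show "s = root 10 s ^ 10" using s_pos by simp
    show "1 \<le> s * real N" using s(1) N3 by (simp add: field_simps)
  qed (rule s(3))
  \<comment> \<open>The fourth root of \<open>N\<close> is the convenient scale:
    \<open>\<alpha>\<close> and \<open>ln N\<close> are both at most a constant times
    \<open>R\<close>, while \<open>1 / s\<close> is at least \<open>R\<^sup>2 / 2\<close>.\<close>
  define R where "R = sqrt (sqrt (real N))"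
  have R2: "R\<^sup>2 = sqrt (real N)" by (simp add: R_def)
  have "R ^ 4 = (R\<^sup>2)\<^sup>2" by (simp flip: power_mult)
  hence R4: "R ^ 4 = real N" by (simp add: R2)
  have R_pos: "0 < R" using N3 by (simp add: R_def)
  \<comment> \<open>Since \<open>12 \<le> X\<close>, \<open>(12 X) ^ 4 \<le> X ^ 8\<close>, far
    below \<open>X ^ 227 \<le> N = R ^ 4\<close>.\<close>
  have XR: "12 * X \<le> R"
  proof (rule power_le_imp_le_base[of _ 3])
    have "(12 * X) ^ 4 \<le> (X * X) ^ 4" using X by (intro power_mono mult_right_mono) auto
    also have "\<dots> = X ^ 8" by (simp flip: power2_eq_square power_mult)
    also have "\<dots> \<le> X ^ 227" using X by (intro power_increasing) auto
    also have "\<dots> \<le> R ^ 4" using N by (simp add: X_def R4)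
    finally show "(12 * X) ^ Suc 3 \<le> R ^ Suc 3" by simp
  qed (use R_pos in simp)
  have "ln (real N) = 4 * ln R" using R_pos by (simp add: ln_realpow flip: R4)
  also have "\<dots> \<le> 4 * R" using R_pos ln_le_minus_one[of R] by simp
  finally have lnN: "ln (real N) \<le> 4 * R" .
  have "\<alpha> * (2 * ln (real N)) \<le> X / 12 * (2 * (4 * R))"
    using \<alpha> X lnN N3 by (intro mult_mono) auto
  also have "\<dots> = 2 / 3 * R * X" by simp
  also have "\<dots> \<le> 2 / 3 * R * (R / 12)" using XR R_pos by (intro mult_left_mono) auto
  also have "\<dots> < 3 / 10 * R\<^sup>2" using R_pos by (simp add: power2_eq_square)
  also have "\<dots> \<le> 3 / (5 * s)"
  proof -
    have "s \<le> sqrt (2\<^sup>2 / real N)"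
    proof (rule order_trans[OF s(2) real_sqrt_le_mono])
      show "5 / 2 / real N \<le> 2\<^sup>2 / real N" by (intro divide_right_mono) simp_all
    qed
    also have "\<dots> = 2 / R\<^sup>2" unfolding R2 real_sqrt_divide by simp
    finally show ?thesis using s_pos R_pos by (simp add: field_simps)
  qed
  also note scaled_second_difference_ge
  finally have main: "\<alpha> * (2 * ln (real N)) < (real N)\<^sup>2 * (L (N + 1) + L (N - 1) - 2 * L N)
                 - real N * (L (N + 1) - L (N - 1)) + 2 * L N" .
  define \<rho> where "\<rho> j = L j - \<alpha> * ln (real j)" for j
  have pos: "0 < overpartitions (N + 1)" "0 < overpartitions (N - 1)" "0 < overpartitions N"
    by (rule overpartitions_pos_and_L(1)[OF P_pos(2)] overpartitions_pos_and_L(1)[OF P_pos(3)]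
        overpartitions_pos_and_L(1)[OF P_pos(1)]; simp)+
  have r_pos: "0 < r \<alpha> j" and ln_r: "ln (r \<alpha> j) = \<rho> j / real j"
    if "0 < overpartitions j" "0 < j" for j
    using that by (simp_all add: r_def \<rho>_def L_def ln_root ln_div ln_powr)
  have N1: "real (N - 1) = real N - 1" "real (N + 1) = real N + 1" "0 < N - 1"
    using \<open>2 \<le> N\<close> by (auto simp: of_nat_diff)
  have "\<alpha> * ((real N)\<^sup>2 * (ln (real N + 1) + ln (real N - 1) - 2 * ln (real N))
                 - real N * (ln (real N + 1) - ln (real N - 1)) + 2 * ln (real N)) \<le> \<alpha> * (2 * ln (real N))"
    using \<alpha> N3 by (intro mult_left_mono ln_second_difference_le) auto
  with main have "0 < (real N)\<^sup>2 * (\<rho> (N + 1) + \<rho> (N - 1) - 2 * \<rho> N)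
                 - real N * (\<rho> (N + 1) - \<rho> (N - 1)) + 2 * \<rho> N"
    unfolding \<rho>_def N1 by (simp add: algebra_simps)
  also have "\<dots> = real N * (real N + 1) * (real N - 1) *
      (\<rho> (N + 1) / (real N + 1) + \<rho> (N - 1) / (real N - 1) - 2 * (\<rho> N / real N))"
    using N3 by (intro second_difference_of_quotients[symmetric]) auto
  finally have conv: "0 < \<rho> (N + 1) / (real N + 1) + \<rho> (N - 1) / (real N - 1) - 2 * (\<rho> N / real N)"
    by (rule zero_less_mult_pos) (use N3 in simp)
  have ln_rs: "ln (r \<alpha> (N + 1)) = \<rho> (N + 1) / (real N + 1)" "ln (r \<alpha> (N - 1)) = \<rho> (N - 1) / (real N - 1)"
    "ln (r \<alpha> N) = \<rho> N / real N"
    using ln_r[OF pos(1)] ln_r[OF pos(2) N1(3)] ln_r[OF pos(3)] \<open>2 \<le> N\<close> unfolding N1 by simp_all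
  have rp: "0 < r \<alpha> (N + 1)" "0 < r \<alpha> (N - 1)" "0 < r \<alpha> N"
    using r_pos[OF pos(1)] r_pos[OF pos(2) N1(3)] r_pos[OF pos(3)] \<open>2 \<le> N\<close> by simp_all
  have "ln ((r \<alpha> N)\<^sup>2) = 2 * ln (r \<alpha> N)"
    using rp by (subst ln_realpow) auto
  also have "\<dots> < ln (r \<alpha> (N - 1)) + ln (r \<alpha> (N + 1))"
    unfolding ln_rs using conv by linarith
  also have "\<dots> = ln (r \<alpha> (N - 1) * r \<alpha> (N + 1))"
    using rp by (subst ln_mult) auto
  finally have "ln ((r \<alpha> N)\<^sup>2) < ln (r \<alpha> (N - 1) * r \<alpha> (N + 1))" .
  thus "(r \<alpha> N)\<^sup>2 < r \<alpha> (N - 1) * r \<alpha> (N + 1)" using rp by simp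
  show "0 < r \<alpha> (N + 1)" by (rule rp)
qed

theorem theorem1p3:
  fixes \<alpha> :: real and n :: nat
  assumes "\<alpha> \<ge> 0"
    and "int n \<ge> N_T \<alpha>"
  shows "card {w. poly (J \<alpha> n) w = 0} = 3 \<and>
         (\<exists>(x :: real) (z :: complex). z \<notin> \<real> \<and>
            {w. poly (J \<alpha> n) w = 0} = {complex_of_real x, z, cnj z})"
proof -
  have "real_of_int (N_T \<alpha>) \<le> real n"
    using assms(2) by (metis of_int_le_iff of_int_of_nat_eq)
  hence n: "(12 + 12 * \<alpha>) ^ 227 \<le> real n" using N_T_ge[of \<alpha>] by linarith
  moreover have "(1 :: real) \<le> (12 + 12 * \<alpha>) ^ 227" using assms(1) by (intro one_le_power) simp
  ultimately have "1 \<le> n" "(12 + 12 * \<alpha>) ^ 227 \<le> real (n + 1)" by simp_all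
  \<comment> \<open>At index \<open>n + 1\<close> the inequality compares the entries in degrees 1,
    2 and 3, so it is the discriminant condition on \<open>a1\<close>, \<open>a2\<close>,
    \<open>a3\<close>.\<close>
  note convex = r_log_convex[OF assms(1) this(2)]
  have "poly (J \<alpha> n) w = of_real (r \<alpha> (n - 1)) + 3 * of_real (r \<alpha> n) * w
      + 3 * of_real (r \<alpha> (n + 1)) * w\<^sup>2 + of_real (r \<alpha> (n + 2)) * w ^ 3" for w
    using \<open>1 \<le> n\<close> by (simp add: J_def poly_sum poly_monom eval_nat_numeral)
  moreover obtain x z where z: "z \<notin> \<real>" and
    "{w. of_real (r \<alpha> (n - 1)) + 3 * of_real (r \<alpha> n) * w + 3 * of_real (r \<alpha> (n + 1)) * w\<^sup>2
        + of_real (r \<alpha> (n + 2)) * w ^ 3 = 0} = {complex_of_real x, z, cnj z}"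
    by (rule cubic_roots_one_real[of "r \<alpha> (n + 2)" "r \<alpha> (n + 1)" "r \<alpha> n" "r \<alpha> (n - 1)"])
      (use convex in auto)
  ultimately have roots: "{w. poly (J \<alpha> n) w = 0} = {complex_of_real x, z, cnj z}" by simp
  have "cnj z \<notin> \<real>" using z by (simp add: complex_is_Real_iff)
  hence "complex_of_real x \<noteq> z" "complex_of_real x \<noteq> cnj z" using z Reals_of_real[of x] by metis+
  moreover have "z \<noteq> cnj z" using z by (metis Reals_cnj_iff)
  ultimately have "card {complex_of_real x, z, cnj z} = 3" by simp
  thus ?thesis unfolding roots using z by blast
qed

end
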